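(* For each $n\ge 1$ let $\{\mathbb{Z}_n(t),\ t\in\mathbb{R}\}$ be a stochastic process such that $\lim_{|t|\to\infty}\mathbb{Z}_n(t)=0$ and whose sample paths are right-continuous and of bounded variation on $\mathbb{R}$. Assume that $\{\mathbb{Z}_n(t),\ t\in\mathbb{R}\}$ converges weakly, as $n\to\infty$, to a Gaussian process $\{\mathbb{Z}(t),\ t\in\mathbb{R}\}$ that has uniformly continuous sample paths with respect to the distance $d(s,t)=|F_0(s)-F_0(t)|$ for some distribution function $F_0$ on $\mathbb{R}$. Then, for any $T<\infty$ and any class $\mathcal{G}\subseteq BV_T'$, the process $\{\bar{\mathbb{Z}}_n(g),\ g\in\mathcal{G}\}$, where $\bar{\mathbb{Z}}_n(g)=\int g(x)\,\mathrm{d}\mathbb{Z}_n(x)$, converges weakly, as $n\to\infty$, to a Gaussian process in $\ell^\infty(\mathcal{G})$ that has uniformly $L_1(F_0)$-continuous sample paths.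
   Context: For $g:\mathbb{R}\to\mathbb{R}$, $\|g\|_{TV}=\sup_{\Pi}\sum_{x_i,x_{i+1}\in\Pi}|g(x_{i+1})-g(x_i)|$, the supremum being over all countable partitions $\Pi=\{x_1<x_2<\dots\}$ of $\mathbb{R}$. For $T>0$, $BV_T=\{g:\mathbb{R}\to\mathbb{R}:\ \|g\|_{TV}\le T,\ \|g\|_\infty\le T\}$ (with $\|\cdot\|_\infty$ the supremum norm), and $BV_T'$ is the set of right-continuous functions in $BV_T$. Integrals $\int g\,\mathrm{d}\mathbb{Z}_n$ are pathwise Lebesgue–Stieltjes integrals. Weak convergence is in the sense of Hoffmann-Jørgensen (expectations interpreted as outer expectations); weak convergence of $\{\mathbb{Z}_n(t),\ t\in\mathbb{R}\}$ is in $\ell^\infty(\mathbb{R})$, where $\ell^\infty(S)$ denotes the bounded real functions on $S$ with the supremum norm. "Uniformly $L_1(F_0)$-continuous" means uniformly continuous on $\mathcal{G}$ with respect to the semi-metric $(f,g)\mapsto\int|f-g|\,\mathrm{d}F_0$. *)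

theory Defs
  imports "HOL-Probability.Probability"
begin

(* Total variation of g over A.  A partition x_1 < x_2 < ... of A is given as an increasing
   sequence in A: finite partitions are the eventually constant sequences, and repeated
   points contribute nothing to the sum. *)
definition variation_on :: "real set \<Rightarrow> (real \<Rightarrow> real) \<Rightarrow> ennreal" where
  "variation_on A g =
     (SUP x\<in>{x :: nat \<Rightarrow> real. incseq x \<and> range x \<subseteq> A}. \<Sum>i. ennreal \<bar>g (x (Suc i)) - g (x i)\<bar>)"

definition tv_norm :: "(real \<Rightarrow> real) \<Rightarrow> ennreal" where
  "tv_norm g = variation_on UNIV g"

definition right_continuous :: "(real \<Rightarrow> real) \<Rightarrow> bool" where
  "right_continuous g \<longleftrightarrow> (\<forall>x. continuous (at_right x) g)"

definition BV :: "real \<Rightarrow> (real \<Rightarrow> real) set" where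
  "BV T = {g. tv_norm g \<le> ennreal T \<and> (\<forall>x. \<bar>g x\<bar> \<le> T)}"

definition BV_rc :: "real \<Rightarrow> (real \<Rightarrow> real) set" where
  "BV_rc T = {g \<in> BV T. right_continuous g}"

(* For F right-continuous with tv_norm F finite, the Lebesgue-Stieltjes integral of g with
   respect to the finite signed measure with mass F b - F a on {a<..b}.  With V the variation
   of F on {..x}, the functions (V + F)/2 and (V - F)/2 are bounded, nondecreasing and
   right-continuous, and they generate the Jordan decomposition of that measure. *)
definition ls_integral :: "(real \<Rightarrow> real) \<Rightarrow> (real \<Rightarrow> real) \<Rightarrow> real" where
  "ls_integral g F =
     (let V = (\<lambda>x. enn2real (variation_on {..x} F))
      in (\<integral>x. g x \<partial>interval_measure (\<lambda>x. (V x + F x) / 2))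
       - (\<integral>x. g x \<partial>interval_measure (\<lambda>x. (V x - F x) / 2)))"

definition distribution_function :: "(real \<Rightarrow> real) \<Rightarrow> bool" where
  "distribution_function F \<longleftrightarrow>
     mono F \<and> right_continuous F \<and> (F \<longlongrightarrow> 0) at_bot \<and> (F \<longlongrightarrow> 1) at_top"

definition unif_cont_wrt :: "'s set \<Rightarrow> ('s \<Rightarrow> 's \<Rightarrow> real) \<Rightarrow> ('s \<Rightarrow> real) \<Rightarrow> bool" where
  "unif_cont_wrt S d f \<longleftrightarrow>
     (\<forall>\<epsilon>>0. \<exists>\<delta>>0. \<forall>s\<in>S. \<forall>t\<in>S. d s t < \<delta> \<longrightarrow> \<bar>f s - f t\<bar> < \<epsilon>)"

definition L1_dist :: "(real \<Rightarrow> real) \<Rightarrow> (real \<Rightarrow> real) \<Rightarrow> (real \<Rightarrow> real) \<Rightarrow> real" where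
  "L1_dist F f g = (\<integral>x. \<bar>f x - g x\<bar> \<partial>interval_measure F)"

(* A process is written as a map from outcomes to sample paths, so X \<omega> s is its value at index s. *)
definition stochastic_process :: "'a measure \<Rightarrow> 's set \<Rightarrow> ('a \<Rightarrow> 's \<Rightarrow> real) \<Rightarrow> bool" where
  "stochastic_process M S X \<longleftrightarrow> (\<forall>s\<in>S. (\<lambda>\<omega>. X \<omega> s) \<in> borel_measurable M)"

(* Degenerate (constant) normal laws are included. *)
definition normal_rv :: "'a measure \<Rightarrow> ('a \<Rightarrow> real) \<Rightarrow> bool" where
  "normal_rv M Y \<longleftrightarrow> Y \<in> borel_measurable M \<and>
     (\<exists>\<mu>. distr M borel Y = return borel \<mu> \<or>
          (\<exists>\<sigma>>0. distributed M lborel Y (normal_density \<mu> \<sigma>)))"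

(* Joint normality of all finite-dimensional marginals, in the usual definition of the
   multivariate normal law by linear combinations; the process need not be centred. *)
definition gaussian_process :: "'a measure \<Rightarrow> 's set \<Rightarrow> ('a \<Rightarrow> 's \<Rightarrow> real) \<Rightarrow> bool" where
  "gaussian_process M S X \<longleftrightarrow> stochastic_process M S X \<and>
     (\<forall>I a. finite I \<and> I \<subseteq> S \<longrightarrow> normal_rv M (\<lambda>\<omega>. \<Sum>s\<in>I. a s * X \<omega> s))"

(* Bounded real functions on S with the supremum metric; as usual for functions on a set S,
   they take the value undefined outside S. *)
definition linf :: "'s set \<Rightarrow> ('s \<Rightarrow> real) metric" where
  "linf S = funspace S euclidean_metric"

definition linf_borel :: "'s set \<Rightarrow> ('s \<Rightarrow> real) measure" where
  "linf_borel S = sigma (mspace (linf S)) {U. openin (mtopology_of (linf S)) U}"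

(* Used for bounded f only, for which admitting majorants U with infinite values would not
   change the infimum. *)
definition outer_expectation :: "'a measure \<Rightarrow> ('a \<Rightarrow> real) \<Rightarrow> real" where
  "outer_expectation M f =
     Inf {integral\<^sup>L M U |U. integrable M U \<and> (\<forall>\<omega>\<in>space M. f \<omega> \<le> U \<omega>)}"

(* Hoffmann-Joergensen weak convergence in linf S of arbitrary, possibly non-measurable maps X n,
   each on its own probability space M n, to a Borel measurable map Y on N. *)
definition weakly_converges ::
  "'s set \<Rightarrow> (nat \<Rightarrow> 'a measure) \<Rightarrow> (nat \<Rightarrow> 'a \<Rightarrow> 's \<Rightarrow> real) \<Rightarrow> 'b measure \<Rightarrow> ('b \<Rightarrow> 's \<Rightarrow> real) \<Rightarrow> bool"
where
  "weakly_converges S M X N Y \<longleftrightarrow>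
     (\<forall>n. X n \<in> space (M n) \<rightarrow> mspace (linf S)) \<and>
     Y \<in> measurable N (linf_borel S) \<and>
     (\<forall>h :: ('s \<Rightarrow> real) \<Rightarrow> real.
        continuous_map (mtopology_of (linf S)) euclideanreal h \<and> bounded (h ` mspace (linf S)) \<longrightarrow>
        (\<lambda>n. outer_expectation (M n) (\<lambda>\<omega>. h (X n \<omega>))) \<longlonglongrightarrow> (\<integral>\<omega>. h (Y \<omega>) \<partial>N))"

lemma mspace_linf: "f \<in> mspace (linf S) \<longleftrightarrow> f \<in> extensional S \<and> bounded (f ` S)"
proof -
  have "Metric_space.mbounded UNIV dist A \<longleftrightarrow> bounded A" for A :: "real set"
    by (simp add: Met_TC.mbounded_def bounded_def subset_iff Bex_def)
  then show ?thesis
    unfolding linf_def by (auto simp: Met_TC.fspace_def)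
qed

lemma mdist_linf:
  assumes "f \<in> mspace (linf S)" "g \<in> mspace (linf S)" "S \<noteq> {}"
  shows "mdist (linf S) f g = (SUP s\<in>S. \<bar>f s - g s\<bar>)"
  using assms by (simp add: linf_def Met_TC.fdist_def dist_real_def)

end

theory Submission
  imports Defs
begin

text \<open>For \<open>g\<close> right-continuous of bounded variation, the Riemann-Stieltjes sums of \<open>g\<close> against \<open>z\<close> over
  the dyadic partition of \<open>[-k, k]\<close>, with \<open>g\<close> taken at right endpoints, are at most
  \<open>3 * T * sup \<bar>z\<bar>\<close> by summation by parts, and converge to the Lebesgue-Stieltjes integral if \<open>z\<close> is
  right-continuous of bounded variation. Hence the set of bounded \<open>z\<close> for which they converge for
  all \<open>g \<in> G\<close> is closed in the supremum norm, and the limit is a Lipschitz map from it to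
  \<open>\<ell>\<^sup>\<infinity>(G)\<close>. The set also contains the paths of the limit \<open>Z\<close>, since an \<open>F\<^sub>0\<close>-uniformly
  continuous path is a uniform limit of \<open>F\<^sub>0\<close>-Lipschitz ones (inf-convolution); for an
  \<open>F\<^sub>0\<close>-Lipschitz path with constant \<open>L\<close> the limit functional is \<open>L\<close>-Lipschitz in \<open>g\<close> for the
  \<open>L\<^sub>1(F\<^sub>0)\<close> distance. The theorem is then the continuous mapping theorem on this closed set;
  Gaussianity persists because the limit process is a pointwise limit of linear combinations of
  values of \<open>Z\<close>.\<close>

subsection \<open>Riemann-Stieltjes sums over dyadic grids\<close>

text \<open>The single index \<open>k\<close> sets both the mesh \<open>1 / 2 ^ k\<close> and the
  window from \<open>- k\<close> (at \<open>i = 0\<close>) to \<open>k\<close> (at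
  \<open>i = 2 * k * 2 ^ k\<close>), so one limit in \<open>k\<close> covers the whole line.\<close>

definition grid :: "nat \<Rightarrow> nat \<Rightarrow> real" where
  "grid k i = real i / 2 ^ k - real k"

text \<open>Makes sense for every \<open>z\<close>, of bounded variation or not. Right endpoints go
  with right-continuous \<open>g\<close> and with half-open cells \<open>{a<..b}\<close>, whose
  Lebesgue-Stieltjes mass is \<open>z b - z a\<close>.\<close>

definition rs_sum :: "nat \<Rightarrow> (real \<Rightarrow> real) \<Rightarrow> (real \<Rightarrow> real) \<Rightarrow> real" where
  "rs_sum k g z =
     (\<Sum>i<2 * k * 2 ^ k. g (grid k (Suc i)) * (z (grid k (Suc i)) - z (grid k i)))"

lemma grid_mono: "i \<le> j \<Longrightarrow> grid k i \<le> grid k j"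
  by (simp add: grid_def divide_right_mono)

lemma right_continuous_lim:
  assumes "right_continuous f" "e > 0"
  obtains d where "d > 0" "\<And>y. x \<le> y \<Longrightarrow> y < x + d \<Longrightarrow> \<bar>f y - f x\<bar> < e"
proof -
  have "(f \<longlongrightarrow> f x) (at_right x)"
    using assms(1) by (simp add: right_continuous_def continuous_within)
  then have "\<forall>\<^sub>F y in at_right x. dist (f y) (f x) < e"
    using assms(2) by (rule tendstoD)
  then obtain b where b: "b > x" "\<And>y. x < y \<Longrightarrow> y < b \<Longrightarrow> dist (f y) (f x) < e"
    by (auto simp: eventually_at_right_field)
  show ?thesis
  proof (rule that)
    show "b - x > 0" using b by simp
    show "\<bar>f y - f x\<bar> < e" if "x \<le> y" "y < x + (b - x)" for y
      using b(2)[of y] that assms(2) by (cases "x = y") (auto simp: dist_real_def)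
  qed
qed

lemma right_continuousI:
  assumes "\<And>x e. e > 0 \<Longrightarrow> \<exists>d>0. \<forall>y. x < y \<and> y < x + d \<longrightarrow> \<bar>f y - f x\<bar> < e"
  shows "right_continuous f"
  unfolding right_continuous_def continuous_within
proof (intro allI tendstoI)
  fix x e :: real assume "e > 0"
  then obtain d where "d > 0" "\<forall>y. x < y \<and> y < x + d \<longrightarrow> \<bar>f y - f x\<bar> < e"
    using assms by blast
  then show "\<forall>\<^sub>F y in at_right x. dist (f y) (f x) < e"
    by (auto simp: eventually_at_right_field dist_real_def intro!: exI[of _ "x + d"])
qed

lemma right_continuous_add:
  "right_continuous f \<Longrightarrow> right_continuous g \<Longrightarrow> right_continuous (\<lambda>x. f x + g x)"
  and right_continuous_diff:
  "right_continuous f \<Longrightarrow> right_continuous g \<Longrightarrow> right_continuous (\<lambda>x. f x - g x)"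
  and right_continuous_cmult: "right_continuous f \<Longrightarrow> right_continuous (\<lambda>x. c * f x)"
  and right_continuous_abs: "right_continuous f \<Longrightarrow> right_continuous (\<lambda>x. \<bar>f x\<bar>)"
  unfolding right_continuous_def by (auto intro!: continuous_intros)

text \<open>The step function whose integral against \<open>interval_measure F\<close> is
  \<open>rs_sum k g F\<close>, for bounded nondecreasing right-continuous \<open>F\<close>.\<close>

definition grid_step :: "nat \<Rightarrow> (real \<Rightarrow> real) \<Rightarrow> real \<Rightarrow> real" where
  "grid_step k g x = (\<Sum>i<2 * k * 2 ^ k. g (grid k (Suc i)) * indicator {grid k i<..grid k (Suc i)} x)"

text \<open>The cells are disjoint, so at most one term survives. Inside the window it is the value
  of \<open>g\<close> at the right endpoint of the cell of \<open>x\<close>, less than one mesh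
  width from \<open>x\<close>.\<close>

lemma grid_step_cases:
  "grid_step k g x = 0 \<or> (\<exists>y. grid_step k g x = g y)"
  "\<bar>x\<bar> + 1 \<le> real k \<Longrightarrow> \<exists>y. x \<le> y \<and> y < x + 1 / 2 ^ k \<and> grid_step k g x = g y"
proof -
  \<comment> \<open>Cells are closed on the right, hence the ceiling minus one. For
    \<open>x \<le> - real k\<close> the function \<open>nat\<close> truncates to \<open>0\<close>;
    the indicator of that cell vanishes at \<open>x\<close>.\<close>
  define i where "i = nat (\<lceil>(x + real k) * 2 ^ k\<rceil> - 1)"
  have mem: "x \<in> {grid k j<..grid k (Suc j)} \<longleftrightarrow> real j < (x + real k) * 2 ^ k \<and> (x + real k) * 2 ^ k \<le> real j + 1" for j
    by (auto simp: grid_def field_simps)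
  have uniq: "j = i" if "x \<in> {grid k j<..grid k (Suc j)}" for j
    using that unfolding mem i_def by linarith
  have eq: "grid_step k g x = (\<Sum>j<2 * k * 2 ^ k. if j = i then g (grid k (Suc i)) * indicator {grid k i<..grid k (Suc i)} x else 0)"
    unfolding grid_step_def using uniq by (intro sum.cong) (auto simp: indicator_def)
  then have eq: "grid_step k g x = (if i < 2 * k * 2 ^ k then g (grid k (Suc i)) * indicator {grid k i<..grid k (Suc i)} x else 0)"
    by simp
  then show "grid_step k g x = 0 \<or> (\<exists>y. grid_step k g x = g y)"
    by (auto simp: indicator_def)
  assume x: "\<bar>x\<bar> + 1 \<le> real k"
  have pos: "(x + real k) * 2 ^ k > 0" using x by (intro mult_pos_pos) auto
  have "(x + real k) * 2 ^ k \<le> (2 * real k) * 2 ^ k" using x by (intro mult_right_mono) auto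
  then have "\<lceil>(x + real k) * 2 ^ k\<rceil> \<le> int (2 * k * 2 ^ k)"
    by (intro ceiling_le) simp
  moreover have "\<lceil>(x + real k) * 2 ^ k\<rceil> \<ge> 1" using pos by linarith
  ultimately have i: "i < 2 * k * 2 ^ k" unfolding i_def by linarith
  have xi: "real i < (x + real k) * 2 ^ k" "(x + real k) * 2 ^ k \<le> real i + 1"
    using pos unfolding i_def by linarith+
  then have "x \<in> {grid k i<..grid k (Suc i)}" using mem by blast
  moreover have "grid k (Suc i) = grid k i + 1 / 2 ^ k"
    by (simp add: grid_def add_divide_distrib)
  ultimately show "\<exists>y. x \<le> y \<and> y < x + 1 / 2 ^ k \<and> grid_step k g x = g y"
    using eq i by (intro exI[of _ "grid k (Suc i)"]) auto
qed

lemma grid_step_LIMSEQ: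
  assumes "right_continuous g"
  shows "(\<lambda>k. grid_step k g x) \<longlonglongrightarrow> g x"
proof (rule LIMSEQ_I)
  fix e :: real assume "e > 0"
  then obtain d where d: "d > 0" "\<And>y. x \<le> y \<Longrightarrow> y < x + d \<Longrightarrow> \<bar>g y - g x\<bar> < e"
    using right_continuous_lim[OF assms] by metis
  obtain n where n: "(1/2::real) ^ n < d"
    using real_arch_pow_inv[OF d(1), of "1/2"] by auto
  define m where "m = max n (nat \<lceil>\<bar>x\<bar> + 1\<rceil>)"
  have "norm (grid_step k g x - g x) < e" if "k \<ge> m" for k
  proof -
    have k: "\<bar>x\<bar> + 1 \<le> real k" using that unfolding m_def by linarith
    obtain y where y: "x \<le> y" "y < x + 1 / 2 ^ k" "grid_step k g x = g y"
      using grid_step_cases(2)[OF k] by blast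
    have "(1/2::real) ^ k \<le> (1/2) ^ n"
      using that by (intro power_decreasing) (auto simp: m_def)
    then have "1 / 2 ^ k < d" using n by (simp add: power_one_over)
    then show ?thesis using d(2)[of y] y by simp
  qed
  then show "\<exists>m. \<forall>k\<ge>m. norm (grid_step k g x - g x) < e" by blast
qed

text \<open>Continuity from below along \<open>{- n<..n}\<close>. The bound makes the measure
  finite, so that constants are integrable majorants.\<close>

lemma emeasure_interval_measure_UNIV_le:
  assumes "mono F" "right_continuous F" "\<And>x. \<bar>F x\<bar> \<le> c"
  shows "emeasure (interval_measure F) UNIV \<le> ennreal (2 * c)"
proof -
  have U: "(\<Union>n. {- real n<..real n}) = UNIV"
  proof safe
    fix x :: real
    obtain n where "\<bar>x\<bar> < real n" using reals_Archimedean2 by blast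
    then show "x \<in> (\<Union>n. {- real n<..real n})" by (intro UN_I[of n]) auto
  qed simp
  have "emeasure (interval_measure F) (\<Union>n. {- real n<..real n})
      = (SUP n. emeasure (interval_measure F) {- real n<..real n})"
    by (intro SUP_emeasure_incseq[symmetric]) (auto simp: incseq_def)
  also have "\<dots> \<le> ennreal (2 * c)"
  proof (rule SUP_least)
    fix n
    have "emeasure (interval_measure F) {- real n<..real n} = F (real n) - F (- real n)"
      using assms by (intro emeasure_interval_measure_Ioc) (auto simp: right_continuous_def mono_def)
    also have "\<dots> \<le> ennreal (2 * c)"
      using assms(3)[of "real n"] assms(3)[of "- real n"] by (intro ennreal_leI) linarith
    finally show "emeasure (interval_measure F) {- real n<..real n} \<le> ennreal (2 * c)" .
  qed
  finally show ?thesis unfolding U .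
qed

text \<open>Dominated convergence for \<open>grid_step k g\<close>, with the constant majorant
  \<open>b\<close>. Measurability of \<open>g\<close> comes from the same pointwise limit.\<close>

lemma rs_sum_LIMSEQ_integral:
  assumes F: "mono F" "right_continuous F" "\<And>x. \<bar>F x\<bar> \<le> c"
    and g: "right_continuous g" "\<And>x. \<bar>g x\<bar> \<le> b"
  shows "(\<lambda>k. rs_sum k g F) \<longlonglongrightarrow> (\<integral>x. g x \<partial>interval_measure F)"
proof -
  let ?M = "interval_measure F"
  have fin: "finite_measure ?M"
    using emeasure_interval_measure_UNIV_le[OF F]
    by (intro finite_measureI) (auto simp: top_unique)
  interpret finite_measure ?M by (rule fin)
  have step_meas[measurable]: "grid_step k g \<in> borel_measurable borel" for k
    unfolding grid_step_def[abs_def] by measurable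
  have meas: "g \<in> borel_measurable borel"
    by (rule borel_measurable_LIMSEQ_real[OF grid_step_LIMSEQ[OF g(1)]]) measurable
  have bd: "norm (grid_step k g x) \<le> b" for k x
    using grid_step_cases(1)[of k g x] g(2) order_trans[OF abs_ge_zero g(2)] by auto
  have step: "(\<integral>x. grid_step k g x \<partial>?M) = rs_sum k g F" for k
  proof -
    have int: "integrable ?M (\<lambda>x. indicator {grid k i<..grid k (Suc i)} x :: real)" for i
      by (intro integrable_real_indicator) (auto simp: emeasure_eq_measure)
    have "(\<integral>x. grid_step k g x \<partial>?M)
        = (\<Sum>i<2 * k * 2 ^ k. g (grid k (Suc i)) * measure ?M {grid k i<..grid k (Suc i)})"
      unfolding grid_step_def using int by (subst Bochner_Integration.integral_sum) auto
    also have "\<dots> = rs_sum k g F"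
      unfolding rs_sum_def using F grid_mono
      by (intro sum.cong refl arg_cong2[where f="(*)"] measure_interval_measure_Ioc)
         (auto simp: mono_def right_continuous_def)
    finally show ?thesis .
  qed
  have "(\<lambda>k. \<integral>x. grid_step k g x \<partial>?M) \<longlonglongrightarrow> (\<integral>x. g x \<partial>?M)"
    using meas bd grid_step_LIMSEQ[OF g(1)]
    by (intro integral_dominated_convergence[where w="\<lambda>_. b"]) auto
  then show "(\<lambda>k. rs_sum k g F) \<longlonglongrightarrow> (\<integral>x. g x \<partial>?M)" by (simp add: step)
qed

lemma rs_sum_diff_right: "rs_sum k g (\<lambda>x. u x - v x) = rs_sum k g u - rs_sum k g v"
  unfolding rs_sum_def by (simp add: sum_subtractf[symmetric] algebra_simps)

lemma rs_sum_cmult_right: "rs_sum k g (\<lambda>x. c * u x) = c * rs_sum k g u"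
  unfolding rs_sum_def by (simp add: sum_distrib_left algebra_simps)

lemma rs_sum_diff_left: "rs_sum k (\<lambda>x. g x - h x) z = rs_sum k g z - rs_sum k h z"
  unfolding rs_sum_def by (simp add: sum_subtractf[symmetric] algebra_simps)

subsection \<open>Total variation\<close>

lemma variation_on_ge:
  assumes "incseq x" "range x \<subseteq> A"
  shows "ennreal (\<Sum>i<n. \<bar>g (x (Suc i)) - g (x i)\<bar>) \<le> variation_on A g"
proof -
  have "ennreal (\<Sum>i<n. \<bar>g (x (Suc i)) - g (x i)\<bar>) = (\<Sum>i<n. ennreal \<bar>g (x (Suc i)) - g (x i)\<bar>)"
    by (simp add: sum_ennreal)
  also have "\<dots> \<le> (\<Sum>i. ennreal \<bar>g (x (Suc i)) - g (x i)\<bar>)"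
    by (rule sum_le_suminf) auto
  also have "\<dots> \<le> variation_on A g"
    unfolding variation_on_def using assms by (intro SUP_upper) auto
  finally show ?thesis .
qed

lemma variation_on_le:
  assumes "\<And>x n. incseq x \<Longrightarrow> range x \<subseteq> A \<Longrightarrow> ennreal (\<Sum>i<n. \<bar>g (x (Suc i)) - g (x i)\<bar>) \<le> c"
  shows "variation_on A g \<le> c"
  unfolding variation_on_def
proof (rule SUP_least)
  fix x :: "nat \<Rightarrow> real" assume "x \<in> {x. incseq x \<and> range x \<subseteq> A}"
  then show "(\<Sum>i. ennreal \<bar>g (x (Suc i)) - g (x i)\<bar>) \<le> c"
    using assms[of x] by (intro suminf_le_const) (auto simp: sum_ennreal)
qed

lemma variation_on_mono: "A \<subseteq> B \<Longrightarrow> variation_on A g \<le> variation_on B g"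
  unfolding variation_on_def by (intro SUP_subset_mono) auto

lemma summation_by_parts:
  fixes g z :: "nat \<Rightarrow> real"
  shows "(\<Sum>i<n. g (Suc i) * (z (Suc i) - z i)) = g n * z n - g 0 * z 0 - (\<Sum>i<n. (g (Suc i) - g i) * z i)"
  by (induction n) (auto simp: algebra_simps)

text \<open>Summation by parts moves the increments to \<open>g\<close> and leaves two boundary
  terms and one variation term, each at most \<open>T * c\<close>. The bound is uniform in
  \<open>k\<close> and sees \<open>z\<close> only through \<open>c\<close>.\<close>

lemma abs_rs_sum_le:
  assumes g: "g \<in> BV T" and z: "\<And>x. \<bar>z x\<bar> \<le> c" and "T \<ge> 0"
  shows "\<bar>rs_sum k g z\<bar> \<le> 3 * T * c"
proof -
  let ?n = "2 * k * 2 ^ k"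
  have c: "c \<ge> 0" using z[of 0] by linarith
  have "ennreal (\<Sum>i<?n. \<bar>g (grid k (Suc i)) - g (grid k i)\<bar>) \<le> tv_norm g"
    unfolding tv_norm_def by (rule variation_on_ge) (auto simp: incseq_def grid_mono)
  also have "\<dots> \<le> ennreal T" using g by (simp add: BV_def)
  finally have tv: "(\<Sum>i<?n. \<bar>g (grid k (Suc i)) - g (grid k i)\<bar>) \<le> T"
    using \<open>T \<ge> 0\<close> by simp
  have gz: "\<bar>g x * z y\<bar> \<le> T * c" for x y
    unfolding abs_mult using g z \<open>T \<ge> 0\<close> by (intro mult_mono) (auto simp: BV_def)
  have "\<bar>\<Sum>i<?n. (g (grid k (Suc i)) - g (grid k i)) * z (grid k i)\<bar>
      \<le> (\<Sum>i<?n. \<bar>g (grid k (Suc i)) - g (grid k i)\<bar> * c)"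
    by (rule order_trans[OF sum_abs]) (auto intro!: sum_mono mult_left_mono z simp: abs_mult)
  also have "\<dots> \<le> T * c"
    using tv c by (auto simp: sum_distrib_right[symmetric] intro: mult_right_mono)
  finally show ?thesis
    unfolding rs_sum_def
    using summation_by_parts[of "\<lambda>i. g (grid k i)" "\<lambda>i. z (grid k i)" ?n]
      gz[of "grid k ?n" "grid k ?n"] gz[of "grid k 0" "grid k 0"] by linarith
qed

text \<open>Any partition of \<open>{..s}\<close> can be continued by \<open>s\<close> and
  \<open>t\<close>, which adds the increment from \<open>s\<close> to \<open>t\<close>.\<close>

lemma variation_on_increment:
  assumes "s \<le> t"
  shows "variation_on {..s} F + ennreal \<bar>F t - F s\<bar> \<le> variation_on {..t} F"
proof -
  have "variation_on {..s} F \<le> variation_on {..t} F - ennreal \<bar>F t - F s\<bar>"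
  proof (rule variation_on_le)
    fix x :: "nat \<Rightarrow> real" and n assume x: "incseq x" "range x \<subseteq> {..s}"
    \<comment> \<open>\<open>q\<close> follows \<open>x\<close> through index \<open>n\<close>,
      visits \<open>s\<close> at \<open>n + 1\<close> and then rests at \<open>t\<close>. The
      increment from \<open>x n\<close> to \<open>s\<close> is dropped as nonnegative.\<close>
    define q where "q i = (if i \<le> n then x i else if i = Suc n then s else t)" for i
    have xs: "x i \<le> s" for i using x(2) by auto
    have "incseq q"
      unfolding incseq_Suc_iff q_def using x(1) xs assms
      by (auto simp: incseq_Suc_iff intro: order_trans)
    moreover have "range q \<subseteq> {..t}"
      unfolding q_def using xs assms by (auto intro: order_trans)
    ultimately have "ennreal (\<Sum>i<Suc (Suc n). \<bar>F (q (Suc i)) - F (q i)\<bar>) \<le> variation_on {..t} F"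
      by (rule variation_on_ge)
    moreover have "(\<Sum>i<n. \<bar>F (q (Suc i)) - F (q i)\<bar>) = (\<Sum>i<n. \<bar>F (x (Suc i)) - F (x i)\<bar>)"
      by (intro sum.cong) (auto simp: q_def)
    then have "(\<Sum>i<n. \<bar>F (x (Suc i)) - F (x i)\<bar>) + \<bar>F t - F s\<bar>
        \<le> (\<Sum>i<Suc (Suc n). \<bar>F (q (Suc i)) - F (q i)\<bar>)"
      by (simp add: q_def)
    then have "ennreal (\<Sum>i<n. \<bar>F (x (Suc i)) - F (x i)\<bar>) + ennreal \<bar>F t - F s\<bar>
        \<le> ennreal (\<Sum>i<Suc (Suc n). \<bar>F (q (Suc i)) - F (q i)\<bar>)"
      by (simp add: sum_nonneg flip: ennreal_plus)
    ultimately have "ennreal (\<Sum>i<n. \<bar>F (x (Suc i)) - F (x i)\<bar>) + ennreal \<bar>F t - F s\<bar> \<le> variation_on {..t} F"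
      by (rule order_trans[rotated])
    then show "ennreal (\<Sum>i<n. \<bar>F (x (Suc i)) - F (x i)\<bar>) \<le> variation_on {..t} F - ennreal \<bar>F t - F s\<bar>"
      by (simp add: ennreal_le_minus_iff)
  qed
  \<comment> \<open>Subtraction in \<open>ennreal\<close> truncates at \<open>0\<close>, so the
    return to the additive form takes this bound, given by the partition with points
    \<open>s\<close> and \<open>t\<close>.\<close>
  moreover have "ennreal \<bar>F t - F s\<bar> \<le> variation_on {..t} F"
    using variation_on_ge[of "\<lambda>i. if i = 0 then s else t" "{..t}" F 1] assms
    by (simp add: incseq_Suc_iff image_subset_iff)
  ultimately show ?thesis
    by (metis add.commute add_left_mono add_diff_inverse_ennreal)
qed

section \<open>The variation function of a function of finite total variation\<close>

context
  fixes F :: "real \<Rightarrow> real" and V :: "real \<Rightarrow> real"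
  assumes fin: "tv_norm F < \<infinity>"
  defines "V \<equiv> \<lambda>x. enn2real (variation_on {..x} F)"
begin

lemma ennreal_variation: "ennreal (V x) = variation_on {..x} F"
proof -
  have "variation_on {..x} F < \<infinity>"
    using variation_on_mono[of "{..x}" UNIV F] fin unfolding tv_norm_def
    by (auto intro: le_less_trans)
  then show ?thesis by (simp add: V_def)
qed

lemma variation_nonneg: "0 \<le> V x"
  by (simp add: V_def)

lemma variation_bounded: "V x \<le> enn2real (tv_norm F)"
  unfolding V_def tv_norm_def using fin
  by (intro enn2real_mono variation_on_mono) (auto simp: tv_norm_def)

lemma abs_diff_le_variation: "s \<le> t \<Longrightarrow> \<bar>F t - F s\<bar> \<le> V t - V s"
  using variation_on_increment[of s t F]
  by (simp add: ennreal_variation[symmetric] variation_nonneg flip: ennreal_plus)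

lemma variation_mono: "s \<le> t \<Longrightarrow> V s \<le> V t"
  using abs_diff_le_variation[of s t] by simp

text \<open>Along a partition of \<open>{..y}\<close> the increments of \<open>U\<close> telescope
  to at most \<open>U y\<close>, so \<open>V\<close> is the least nonnegative function whose
  increments dominate those of \<open>F\<close>.\<close>

lemma variation_minimal:
  assumes "\<And>s t. s \<le> t \<Longrightarrow> \<bar>F t - F s\<bar> \<le> U t - U s" "\<And>t. 0 \<le> U t"
  shows "V y \<le> U y"
proof -
  have "variation_on {..y} F \<le> ennreal (U y)"
  proof (rule variation_on_le)
    fix x :: "nat \<Rightarrow> real" and n assume x: "incseq x" "range x \<subseteq> {..y}"
    have "(\<Sum>i<n. \<bar>F (x (Suc i)) - F (x i)\<bar>) \<le> (\<Sum>i<n. U (x (Suc i)) - U (x i))"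
      using x(1) by (intro sum_mono assms(1)) (auto simp: incseq_Suc_iff)
    also have "\<dots> = U (x n) - U (x 0)" by (rule sum_lessThan_telescope)
    also have "\<dots> \<le> U y"
      using assms(1)[of "x n" y] assms(2)[of "x 0"] x(2) by fastforce
    finally show "ennreal (\<Sum>i<n. \<bar>F (x (Suc i)) - F (x i)\<bar>) \<le> ennreal (U y)"
      by (rule ennreal_leI)
  qed
  then show ?thesis using assms(2) by (simp add: ennreal_variation[symmetric])
qed

text \<open>Lowering \<open>V\<close> on \<open>{x<..}\<close> by a jump at \<open>x\<close> would leave a nonnegative function whose
  increments still dominate those of \<open>F\<close>, contrary to the minimality of \<open>V\<close>.\<close>

lemma right_continuous_variation:
  assumes rc: "right_continuous F"
  shows "right_continuous V"
proof (rule right_continuousI, rule ccontr)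
  fix x e :: real assume e: "e > 0" and
    "\<not> (\<exists>d>0. \<forall>y. x < y \<and> y < x + d \<longrightarrow> \<bar>V y - V x\<bar> < e)"
  then have *: "\<exists>y. x < y \<and> y < x + d \<and> \<not> \<bar>V y - V x\<bar> < e" if "d > 0" for d
    using that by blast
  \<comment> \<open>Points arbitrarily close to \<open>x\<close> from the right show the jump;
    monotonicity of \<open>V\<close> carries it to every \<open>y > x\<close>.\<close>
  have jump: "V x + e \<le> V y" if "x < y" for y
  proof -
    obtain y' where "x < y'" "y' < x + (y - x)" "\<not> \<bar>V y' - V x\<bar> < e"
      using *[of "y - x"] \<open>x < y\<close> by auto
    then show ?thesis using variation_mono[of y' y] variation_mono[of x y'] by linarith
  qed
  define U where "U t = (if t \<le> x then V t else V t - e)" for t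
  have "V (x + 1) \<le> U (x + 1)"
  proof (rule variation_minimal)
    show "0 \<le> U t" for t
      using jump[of t] variation_nonneg[of t] variation_nonneg[of x] by (auto simp: U_def)
    fix s t :: real assume st: "s \<le> t"
    show "\<bar>F t - F s\<bar> \<le> U t - U s"
    proof (cases "s \<le> x \<and> x < t")
      case False
      then show ?thesis using abs_diff_le_variation[OF st] st by (auto simp: U_def)
    next
      case True
      \<comment> \<open>The way from \<open>s\<close> to \<open>t\<close> is split at
        \<open>x\<close> and at a point \<open>y\<close> just to its right. Between \<open>x\<close>
        and \<open>y\<close> the function \<open>F\<close> moves by less than \<open>r\<close>,
        while \<open>V\<close> gains at least \<open>e\<close>, which pays for the lowering in
        \<open>U\<close>.\<close>
      have "\<bar>F t - F s\<bar> \<le> U t - U s + r" if r: "r > 0" for r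
      proof -
        obtain d where d: "d > 0" "\<And>y. x \<le> y \<Longrightarrow> y < x + d \<Longrightarrow> \<bar>F y - F x\<bar> < r"
          using right_continuous_lim[OF rc r] by metis
        define y where "y = min t (x + d / 2)"
        have y: "x < y" "y \<le> t" "y < x + d" using True d(1) by (auto simp: y_def)
        then show ?thesis
          using abs_diff_le_variation[of y t] abs_diff_le_variation[of s x] d(2)[of y] jump[of y] True
          by (auto simp: U_def)
      qed
      then show ?thesis by (rule field_le_epsilon)
    qed
  qed
  then show False using e by (simp add: U_def)
qed

lemma bounded_of_finite_variation: "\<bar>F x\<bar> \<le> \<bar>F 0\<bar> + enn2real (tv_norm F)"
  using abs_diff_le_variation[of 0 x] abs_diff_le_variation[of x 0]
    variation_bounded[of x] variation_bounded[of 0] variation_nonneg[of x] variation_nonneg[of 0]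
  by linarith

text \<open>The nondecreasing case applies to \<open>(V + F) / 2\<close> and
  \<open>(V - F) / 2\<close>, the two functions in \<open>ls_integral\<close>. Their difference is
  \<open>F\<close>, and \<open>rs_sum\<close> is linear in the integrator.\<close>

lemma rs_sum_LIMSEQ_ls_integral:
  assumes rc: "right_continuous F" and g: "right_continuous g" "\<And>x. \<bar>g x\<bar> \<le> b"
  shows "(\<lambda>k. rs_sum k g F) \<longlonglongrightarrow> ls_integral g F"
proof -
  define c where "c = \<bar>F 0\<bar> + enn2real (tv_norm F)"
  note rcs = right_continuous_variation[OF rc] rc
  have V: "\<bar>V x\<bar> \<le> c" "\<bar>F x\<bar> \<le> c" for x
    using variation_bounded[of x] variation_nonneg[of x] bounded_of_finite_variation[of x]
    unfolding c_def by linarith+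
  have "(\<lambda>k. rs_sum k g (\<lambda>x. (V x + F x) / 2)) \<longlonglongrightarrow> (\<integral>x. g x \<partial>interval_measure (\<lambda>x. (V x + F x) / 2))"
  proof (rule rs_sum_LIMSEQ_integral[OF _ _ _ g])
    show "mono (\<lambda>x. (V x + F x) / 2)"
      proof (rule monoI)
      fix x y :: real assume "x \<le> y"
      from abs_diff_le_variation[OF this] show "(V x + F x) / 2 \<le> (V y + F y) / 2"
        by (simp add: abs_le_iff)
    qed
    show "right_continuous (\<lambda>x. (V x + F x) / 2)"
      using right_continuous_cmult[OF right_continuous_add[OF rcs], of "1/2"] by simp
    show "\<bar>(V x + F x) / 2\<bar> \<le> c" for x using V[of x] by (auto simp: abs_le_iff)
  qed
  moreover have "(\<lambda>k. rs_sum k g (\<lambda>x. (V x - F x) / 2)) \<longlonglongrightarrow> (\<integral>x. g x \<partial>interval_measure (\<lambda>x. (V x - F x) / 2))"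
  proof (rule rs_sum_LIMSEQ_integral[OF _ _ _ g])
    show "mono (\<lambda>x. (V x - F x) / 2)"
      proof (rule monoI)
      fix x y :: real assume "x \<le> y"
      from abs_diff_le_variation[OF this] show "(V x - F x) / 2 \<le> (V y - F y) / 2"
        by (simp add: abs_le_iff)
    qed
    show "right_continuous (\<lambda>x. (V x - F x) / 2)"
      using right_continuous_cmult[OF right_continuous_diff[OF rcs], of "1/2"] by simp
    show "\<bar>(V x - F x) / 2\<bar> \<le> c" for x using V[of x] by (auto simp: abs_le_iff)
  qed
  ultimately have "(\<lambda>k. rs_sum k g (\<lambda>x. (V x + F x) / 2) - rs_sum k g (\<lambda>x. (V x - F x) / 2)) \<longlonglongrightarrow> ls_integral g F"
    unfolding ls_integral_def Let_def V_def by (rule tendsto_diff)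
  moreover have "F = (\<lambda>x. (V x + F x) / 2 - (V x - F x) / 2)"
    by (rule ext) (simp add: field_simps)
  then have "rs_sum k g F = rs_sum k g (\<lambda>x. (V x + F x) / 2) - rs_sum k g (\<lambda>x. (V x - F x) / 2)" for k
    by (metis rs_sum_diff_right)
  ultimately show ?thesis by (simp only:)
qed

end

subsection \<open>Integrators that are uniformly continuous with respect to a distribution function\<close>

text \<open>Inf-convolution of \<open>z\<close> with the penalty
  \<open>L * \<bar>F s - F t\<bar>\<close>: every competitor is \<open>L\<close>-Lipschitz in
  \<open>s\<close>, hence so is the infimum, and \<open>t = s\<close> shows that it lies below
  \<open>z\<close>.\<close>

lemma lipschitz_approximation:
  fixes F z :: "'s \<Rightarrow> real"
  assumes uc: "unif_cont_wrt UNIV (\<lambda>s t. \<bar>F s - F t\<bar>) z" and z: "\<And>x. \<bar>z x\<bar> \<le> c" and "e > 0"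
  obtains w L where "L \<ge> 0" "\<And>s t. \<bar>w s - w t\<bar> \<le> L * \<bar>F s - F t\<bar>" "\<And>s. \<bar>w s - z s\<bar> \<le> e"
proof -
  have "\<exists>d>0. \<forall>s\<in>UNIV. \<forall>t\<in>UNIV. \<bar>F s - F t\<bar> < d \<longrightarrow> \<bar>z s - z t\<bar> < e"
    using uc \<open>e > 0\<close> unfolding unif_cont_wrt_def by (elim allE[of _ e] impE)
  then obtain d where d: "d > 0" "\<And>s t. \<bar>F s - F t\<bar> < d \<Longrightarrow> \<bar>z s - z t\<bar> < e"
    by auto
  have c: "c \<ge> 0" using z[of undefined] by linarith
  \<comment> \<open>At distance at least \<open>d\<close> the penalty is then at least
    \<open>2 * c\<close>, a bound for the oscillation of \<open>z\<close>; at smaller distances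
    uniform continuity keeps the loss below \<open>e\<close>.\<close>
  define L where "L = 2 * c / d"
  have L: "L \<ge> 0" using c d(1) by (simp add: L_def)
  define w where "w s = (INF t. z t + L * \<bar>F s - F t\<bar>)" for s
  have bdd: "bdd_below (range (\<lambda>t. z t + L * \<bar>F s - F t\<bar>))" for s
  proof (rule bdd_belowI2)
    show "- c \<le> z t + L * \<bar>F s - F t\<bar>" for t
      using z[of t] mult_nonneg_nonneg[OF L abs_ge_zero, of "F s - F t"] by linarith
  qed
  have upper: "w s \<le> z t + L * \<bar>F s - F t\<bar>" for s t
    unfolding w_def by (rule cINF_lower[OF bdd]) simp
  have lower: "r \<le> w s" if "\<And>t. r \<le> z t + L * \<bar>F s - F t\<bar>" for r s
    unfolding w_def using that by (intro cINF_greatest) auto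
  show ?thesis
  proof (rule that[OF L])
    have lip: "w s - L * \<bar>F s - F t\<bar> \<le> w t" for s t
    proof (rule lower)
      fix u
      have "L * \<bar>F s - F u\<bar> \<le> L * (\<bar>F s - F t\<bar> + \<bar>F t - F u\<bar>)"
        using L by (intro mult_left_mono) auto
      then show "w s - L * \<bar>F s - F t\<bar> \<le> z u + L * \<bar>F t - F u\<bar>"
        using upper[of s u] by (simp add: algebra_simps)
    qed
    show "\<bar>w s - w t\<bar> \<le> L * \<bar>F s - F t\<bar>" for s t
      using lip[of s t] lip[of t s] by (simp add: abs_minus_commute abs_le_iff)
    fix s
    have "z s - e \<le> w s"
    proof (rule lower)
      fix t
      show "z s - e \<le> z t + L * \<bar>F s - F t\<bar>"
      proof (cases "\<bar>F s - F t\<bar> < d")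
        case True
        then show ?thesis
          using d(2)[OF True] mult_nonneg_nonneg[OF L abs_ge_zero, of "F s - F t"] by linarith
      next
        case False
        then have "L * d \<le> L * \<bar>F s - F t\<bar>" using L by (intro mult_left_mono) auto
        then show ?thesis
          using z[of s] z[of t] \<open>e > 0\<close> d(1) by (simp add: L_def)
      qed
    qed
    then show "\<bar>w s - z s\<bar> \<le> e" using upper[of s s] \<open>e > 0\<close> by auto
  qed
qed

lemma distribution_function_bounded:
  assumes "distribution_function F"
  shows "\<bar>F x\<bar> \<le> 1"
proof -
  have F: "mono F" "(F \<longlongrightarrow> 0) at_bot" "(F \<longlongrightarrow> 1) at_top"
    using assms by (auto simp: distribution_function_def)
  have "0 \<le> F x"
  proof (rule tendsto_upperbound[OF F(2)])
    show "\<forall>\<^sub>F y in at_bot. F y \<le> F x"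
      using eventually_le_at_bot[of x] by eventually_elim (rule monoD[OF F(1)])
  qed simp
  moreover have "F x \<le> 1"
  proof (rule tendsto_lowerbound[OF F(3)])
    show "\<forall>\<^sub>F y in at_top. F x \<le> F y"
      using eventually_ge_at_top[of x] by eventually_elim (rule monoD[OF F(1)])
  qed simp
  ultimately show ?thesis by simp
qed

section \<open>Integrators that are Lipschitz with respect to a distribution function\<close>

context
  fixes F w :: "real \<Rightarrow> real" and L :: real
  assumes F: "distribution_function F" and L: "L \<ge> 0"
    and w: "\<And>s t. \<bar>w s - w t\<bar> \<le> L * \<bar>F s - F t\<bar>"
begin

text \<open>\<open>w + L * F\<close> is bounded, nondecreasing and right-continuous, so
  \<open>w\<close> is the difference of two integrators for which the sums converge.\<close>

lemma rs_sum_convergent_lipschitz: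
  assumes g: "right_continuous g" "\<And>x. \<bar>g x\<bar> \<le> b"
  shows "convergent (\<lambda>k. rs_sum k g w)"
proof -
  have F': "mono F" "right_continuous F" using F by (auto simp: distribution_function_def)
  have bd: "\<bar>F x\<bar> \<le> 1" for x by (rule distribution_function_bounded[OF F])
  \<comment> \<open>Of the \<open>3 * L\<close>, two parts come from
    \<open>\<bar>F x - F 0\<bar> \<le> 2\<close> and one from
    \<open>\<bar>F x\<bar> \<le> 1\<close>.\<close>
  have wb: "\<bar>w x + L * F x\<bar> \<le> \<bar>w 0\<bar> + 3 * L" for x
  proof -
    have "L * \<bar>F x - F 0\<bar> \<le> L * 2" using bd[of x] bd[of 0] L by (intro mult_left_mono) linarith+
    moreover have "\<bar>L * F x\<bar> \<le> L * 1" unfolding abs_mult using bd L by (intro mult_mono) auto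
    ultimately show ?thesis using w[of x 0] by linarith
  qed
  have rcw: "right_continuous w"
  proof (rule right_continuousI)
    fix x e :: real assume "e > 0"
    \<comment> \<open>\<open>L + 1\<close> in place of \<open>L\<close> allows \<open>L = 0\<close>
      and makes the final inequality strict.\<close>
    then have "e / (L + 1) > 0" using L by simp
    then obtain d where d: "d > 0" "\<And>y. x \<le> y \<Longrightarrow> y < x + d \<Longrightarrow> \<bar>F y - F x\<bar> < e / (L + 1)"
      using right_continuous_lim[OF F'(2)] by metis
    have "\<bar>w y - w x\<bar> < e" if "x < y" "y < x + d" for y
    proof -
      have "\<bar>w y - w x\<bar> \<le> L * \<bar>F y - F x\<bar>" by (rule w)
      also have "\<dots> \<le> L * (e / (L + 1))" using d(2)[of y] that L by (intro mult_left_mono) auto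
      also have "\<dots> < e" using L \<open>e > 0\<close> by (simp add: field_simps)
      finally show ?thesis .
    qed
    then show "\<exists>d>0. \<forall>y. x < y \<and> y < x + d \<longrightarrow> \<bar>w y - w x\<bar> < e" using d(1) by blast
  qed
  have mono: "mono (\<lambda>x. w x + L * F x)"
  proof (rule monoI)
    fix x y :: real assume "x \<le> y"
    then have "F x \<le> F y" using F'(1) by (auto dest: monoD)
    then show "w x + L * F x \<le> w y + L * F y"
      using w[of x y] by (simp add: abs_le_iff algebra_simps)
  qed
  have rc: "right_continuous (\<lambda>x. w x + L * F x)"
    by (intro right_continuous_add right_continuous_cmult rcw F')
  have w_eq: "w = (\<lambda>x. (w x + L * F x) - L * F x)" by simp
  have eq: "(\<lambda>k. rs_sum k g w) = (\<lambda>k. rs_sum k g (\<lambda>x. w x + L * F x) - L * rs_sum k g F)"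
    by (subst w_eq) (simp only: rs_sum_diff_right rs_sum_cmult_right)
  have "(\<lambda>k. rs_sum k g (\<lambda>x. w x + L * F x) - L * rs_sum k g F) \<longlonglongrightarrow>
      (\<integral>x. g x \<partial>interval_measure (\<lambda>x. w x + L * F x)) - L * (\<integral>x. g x \<partial>interval_measure F)"
    by (intro tendsto_diff tendsto_mult tendsto_const
        rs_sum_LIMSEQ_integral[OF mono rc wb g] rs_sum_LIMSEQ_integral[OF F' bd g])
  then show ?thesis unfolding eq by (rule convergentI)
qed

lemma abs_rs_sum_lipschitz_le: "\<bar>rs_sum k g w\<bar> \<le> L * rs_sum k (\<lambda>x. \<bar>g x\<bar>) F"
proof -
  have "\<bar>g (grid k (Suc i)) * (w (grid k (Suc i)) - w (grid k i))\<bar>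
      \<le> L * (\<bar>g (grid k (Suc i))\<bar> * (F (grid k (Suc i)) - F (grid k i)))" for i
  proof -
    have "F (grid k i) \<le> F (grid k (Suc i))"
      using F by (intro monoD[of F] grid_mono) (simp_all add: distribution_function_def)
    then have "\<bar>w (grid k (Suc i)) - w (grid k i)\<bar> \<le> L * (F (grid k (Suc i)) - F (grid k i))"
      using w[of "grid k (Suc i)" "grid k i"] by simp
    from mult_left_mono[OF this abs_ge_zero[of "g (grid k (Suc i))"]] show ?thesis
      unfolding abs_mult by (simp only: mult.left_commute)
  qed
  then show ?thesis
    unfolding rs_sum_def sum_distrib_left by (rule order_trans[OF sum_abs sum_mono])
qed

end

text \<open>A Cauchy argument in three parts: replacing \<open>z\<close> by \<open>w\<close> changes
  all sums by at most \<open>3 * T * (e / (9 * T)) = e / 3\<close>, uniformly in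
  \<open>k\<close>.\<close>

lemma rs_sum_convergent_uniform_limit:
  assumes g: "g \<in> BV T" "T > 0"
    and approx: "\<And>e. e > 0 \<Longrightarrow> \<exists>w. (\<forall>x. \<bar>z x - w x\<bar> \<le> e) \<and> convergent (\<lambda>k. rs_sum k g w)"
  shows "convergent (\<lambda>k. rs_sum k g z)"
proof -
  have "Cauchy (\<lambda>k. rs_sum k g z)"
  proof (rule metric_CauchyI)
    fix e :: real assume "e > 0"
    then have "e / (9 * T) > 0" using g(2) by simp
    then obtain w where w: "\<And>x. \<bar>z x - w x\<bar> \<le> e / (9 * T)" "convergent (\<lambda>k. rs_sum k g w)"
      using approx by blast
    have close: "\<bar>rs_sum k g z - rs_sum k g w\<bar> \<le> e / 3" for k
      using abs_rs_sum_le[OF g(1) w(1), of k] g(2) by (simp add: rs_sum_diff_right)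
    obtain n where n: "\<And>i j. i \<ge> n \<Longrightarrow> j \<ge> n \<Longrightarrow> dist (rs_sum i g w) (rs_sum j g w) < e / 3"
      using metric_CauchyD[OF convergent_Cauchy[OF w(2)], of "e / 3"] \<open>e > 0\<close> by (metis zero_less_divide_iff zero_less_numeral)
    have "dist (rs_sum i g z) (rs_sum j g z) < e" if "i \<ge> n" "j \<ge> n" for i j
      using close[of i] close[of j] n[OF that] unfolding dist_real_def by linarith
    then show "\<exists>n. \<forall>i\<ge>n. \<forall>j\<ge>n. dist (rs_sum i g z) (rs_sum j g z) < e" by blast
  qed
  then show ?thesis by (rule Cauchy_convergent)
qed

definition rs_lim :: "(real \<Rightarrow> real) \<Rightarrow> (real \<Rightarrow> real) \<Rightarrow> real" where
  "rs_lim g z = lim (\<lambda>k. rs_sum k g z)"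

lemma rs_lim_LIMSEQ: "convergent (\<lambda>k. rs_sum k g z) \<Longrightarrow> (\<lambda>k. rs_sum k g z) \<longlonglongrightarrow> rs_lim g z"
  by (simp add: rs_lim_def convergent_LIMSEQ_iff)

text \<open>The bound on the sums, applied to \<open>z - w\<close>, survives the limit. Its constant
  is the same for all \<open>g\<close> in \<open>BV T\<close>.\<close>

lemma abs_rs_lim_diff_le:
  assumes "g \<in> BV T" "T \<ge> 0" "\<And>x. \<bar>z x - w x\<bar> \<le> c"
    and "convergent (\<lambda>k. rs_sum k g z)" "convergent (\<lambda>k. rs_sum k g w)"
  shows "\<bar>rs_lim g z - rs_lim g w\<bar> \<le> 3 * T * c"
proof (rule LIMSEQ_le_const2)
  show "(\<lambda>k. \<bar>rs_sum k g z - rs_sum k g w\<bar>) \<longlonglongrightarrow> \<bar>rs_lim g z - rs_lim g w\<bar>"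
    by (intro tendsto_intros rs_lim_LIMSEQ assms)
  show "\<exists>n. \<forall>k\<ge>n. \<bar>rs_sum k g z - rs_sum k g w\<bar> \<le> 3 * T * c"
    using abs_rs_sum_le[of g T "\<lambda>x. z x - w x" c] assms by (simp add: rs_sum_diff_right)
qed

section \<open>From Lipschitz to uniformly continuous integrators\<close>

context
  fixes F z :: "real \<Rightarrow> real" and c T :: real
  assumes F: "distribution_function F" and T: "T > 0"
    and z: "unif_cont_wrt UNIV (\<lambda>s t. \<bar>F s - F t\<bar>) z" "\<And>x. \<bar>z x\<bar> \<le> c"
begin

lemma rs_sum_convergent_unif_cont:
  assumes g: "g \<in> BV_rc T"
  shows "convergent (\<lambda>k. rs_sum k g z)"
proof (rule rs_sum_convergent_uniform_limit[OF _ T])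
  show "g \<in> BV T" using g by (simp add: BV_rc_def)
  fix e :: real assume "e > 0"
  obtain w L where wL: "L \<ge> 0" "\<And>s t. \<bar>w s - w t\<bar> \<le> L * \<bar>F s - F t\<bar>" "\<And>s. \<bar>w s - z s\<bar> \<le> e"
    by (rule lipschitz_approximation[OF z \<open>e > 0\<close>], rule that)
  have "convergent (\<lambda>k. rs_sum k g w)"
    by (rule rs_sum_convergent_lipschitz[OF F wL(1,2)]) (use g in \<open>auto simp: BV_rc_def BV_def\<close>)
  then show "\<exists>w. (\<forall>x. \<bar>z x - w x\<bar> \<le> e) \<and> convergent (\<lambda>k. rs_sum k g w)"
    using wL(3) by (auto simp: abs_minus_commute)
qed

text \<open>An \<open>F\<close>-Lipschitz \<open>w\<close> replaces \<open>z\<close> at a cost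
  uniform over \<open>BV_rc T\<close>; for \<open>w\<close> the functional is
  \<open>L\<close>-Lipschitz in \<open>g\<close> for \<open>L1_dist F\<close>.\<close>

lemma unif_cont_rs_lim: "unif_cont_wrt (BV_rc T) (L1_dist F) (\<lambda>g. rs_lim g z)"
  unfolding unif_cont_wrt_def
proof (intro allI impI)
  fix e :: real assume e: "e > 0"
  \<comment> \<open>\<open>3 * T * r\<close> is \<open>e / 4\<close>, an error made twice; the other
    \<open>e / 2\<close> is left for the change from \<open>g\<close> to \<open>h\<close> with
    \<open>w\<close> fixed.\<close>
  define r where "r = e / (12 * T)"
  have r: "r > 0" using e T by (simp add: r_def)
  obtain w L where wL: "L \<ge> 0" "\<And>s t. \<bar>w s - w t\<bar> \<le> L * \<bar>F s - F t\<bar>" "\<And>s. \<bar>w s - z s\<bar> \<le> r"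
    by (rule lipschitz_approximation[OF z r], rule that)
  have conv: "convergent (\<lambda>k. rs_sum k g w)" if "g \<in> BV_rc T" for g
    by (rule rs_sum_convergent_lipschitz[OF F wL(1,2)]) (use that in \<open>auto simp: BV_rc_def BV_def\<close>)
  have F': "mono F" "right_continuous F" using F by (auto simp: distribution_function_def)
  have main: "\<bar>rs_lim g w - rs_lim h w\<bar> \<le> L * L1_dist F g h" if g: "g \<in> BV_rc T" and h: "h \<in> BV_rc T" for g h
  proof (rule LIMSEQ_le)
    show "(\<lambda>k. \<bar>rs_sum k g w - rs_sum k h w\<bar>) \<longlonglongrightarrow> \<bar>rs_lim g w - rs_lim h w\<bar>"
      by (intro tendsto_intros rs_lim_LIMSEQ conv g h)
    have rc: "right_continuous (\<lambda>x. \<bar>g x - h x\<bar>)"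
      using g h by (intro right_continuous_abs right_continuous_diff) (auto simp: BV_rc_def)
    have bd: "\<bar>\<bar>g x - h x\<bar>\<bar> \<le> 2 * T" for x
    proof -
      have "\<bar>g x\<bar> \<le> T" "\<bar>h x\<bar> \<le> T" using g h by (auto simp: BV_rc_def BV_def)
      then show ?thesis by linarith
    qed
    show "(\<lambda>k. L * rs_sum k (\<lambda>x. \<bar>g x - h x\<bar>) F) \<longlonglongrightarrow> L * L1_dist F g h"
      unfolding L1_dist_def
      by (intro tendsto_mult tendsto_const
          rs_sum_LIMSEQ_integral[OF F' distribution_function_bounded[OF F] rc bd])
    show "\<exists>n. \<forall>k\<ge>n. \<bar>rs_sum k g w - rs_sum k h w\<bar> \<le> L * rs_sum k (\<lambda>x. \<bar>g x - h x\<bar>) F"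
      using abs_rs_sum_lipschitz_le[OF F wL(1,2), of _ "\<lambda>x. g x - h x"]
      by (simp add: rs_sum_diff_left)
  qed
  have close: "\<bar>rs_lim g w - rs_lim g z\<bar> \<le> e / 4" if "g \<in> BV_rc T" for g
    using abs_rs_lim_diff_le[where T=T, OF _ _ wL(3) conv[OF that] rs_sum_convergent_unif_cont[OF that]] that T
    by (simp add: BV_rc_def r_def)
  show "\<exists>d>0. \<forall>s\<in>BV_rc T. \<forall>t\<in>BV_rc T. L1_dist F s t < d \<longrightarrow> \<bar>rs_lim s z - rs_lim t z\<bar> < e"
  proof (intro exI[of _ "e / (2 * (L + 1))"] conjI ballI impI)
    show "0 < e / (2 * (L + 1))" using e wL(1) by simp
    fix g h assume gh: "g \<in> BV_rc T" "h \<in> BV_rc T" and d: "L1_dist F g h < e / (2 * (L + 1))"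
    have "L * L1_dist F g h \<le> L * (e / (2 * (L + 1)))"
      using d wL(1) by (intro mult_left_mono) auto
    also have "\<dots> < e / 2" using wL(1) e by (simp add: field_simps)
    finally have "\<bar>rs_lim g w - rs_lim h w\<bar> < e / 2" using main[OF gh] by simp
    then show "\<bar>rs_lim g z - rs_lim h z\<bar> < e"
      using close[OF gh(1)] close[OF gh(2)] by linarith
  qed
qed

end

subsection \<open>Limits of normal random variables\<close>

text \<open>For a standard normal \<open>t\<close>, the expectation of \<open>iexp (t * d)\<close> is \<open>exp (- d\<^sup>2 / 2)\<close>, so a phase
  difference \<open>d\<close> bounded away from \<open>0\<close> cannot average to \<open>1\<close>.\<close>

lemma convergent_of_convergent_iexp:
  fixes a :: "nat \<Rightarrow> real"
  assumes conv: "\<And>t. (\<lambda>n. iexp (t * a n)) \<longlonglongrightarrow> \<psi> t"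
  shows "convergent a"
proof -
  have "Cauchy a"
  proof (rule ccontr)
    assume "\<not> Cauchy a"
    then obtain e where e: "e > 0" "\<forall>k. \<exists>m\<ge>k. \<exists>n\<ge>k. \<not> dist (a m) (a n) < e"
      unfolding Cauchy_def by blast
    obtain m n where mn: "\<And>k. m k \<ge> k" "\<And>k. n k \<ge> k" "\<And>k. \<not> dist (a (m k)) (a (n k)) < e"
      using e(2) by metis
    define d where "d k = a (m k) - a (n k)" for k
    have lim: "filterlim m sequentially sequentially" "filterlim n sequentially sequentially"
      using mn(1,2) by (auto intro!: filterlim_at_top_mono[OF filterlim_ident] always_eventually)
    have iexp_d: "(\<lambda>k. iexp (d k * t)) \<longlonglongrightarrow> 1" for t
    proof -
      \<comment> \<open>All terms have modulus \<open>1\<close>, hence so does the limit, and the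
        limits along \<open>m\<close> and \<open>n\<close> may be divided.\<close>
      have "(\<lambda>n. norm (iexp (t * a n))) \<longlonglongrightarrow> norm (\<psi> t)" by (intro tendsto_norm conv)
      then have "(\<lambda>n::nat. 1::real) \<longlonglongrightarrow> norm (\<psi> t)" by (simp only: norm_exp_i_times)
      then have "norm (\<psi> t) = 1" by (simp add: LIMSEQ_const_iff)
      then have nz: "\<psi> t \<noteq> 0" by auto
      have "(\<lambda>k. iexp (t * a (m k)) / iexp (t * a (n k))) \<longlonglongrightarrow> \<psi> t / \<psi> t"
        by (intro tendsto_divide filterlim_compose[OF conv] lim nz)
      moreover have "iexp (t * a (m k)) / iexp (t * a (n k)) = iexp (d k * t)" for k
        by (simp add: d_def exp_diff[symmetric] algebra_simps)
      ultimately show ?thesis using nz by simp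
    qed
    interpret std: real_distribution std_normal_distribution by (rule real_dist_normal_dist)
    have "(\<lambda>k. CLINT x|std_normal_distribution. iexp (d k * x)) \<longlonglongrightarrow> (CLINT x|std_normal_distribution. 1)"
      by (rule integral_dominated_convergence[where w="\<lambda>_. 1"])
         (auto intro!: always_eventually iexp_d[simplified] simp: norm_exp_i_times)
    then have "(\<lambda>k. char std_normal_distribution (d k)) \<longlonglongrightarrow> 1"
      using std.prob_space by (simp add: char_def)
    then have "(\<lambda>k. norm (char std_normal_distribution (d k))) \<longlonglongrightarrow> norm (1::complex)"
      by (rule tendsto_norm)
    then have "(\<lambda>k. exp (- (d k)\<^sup>2 / 2)) \<longlonglongrightarrow> 1"
      by (simp only: char_std_normal_distribution norm_of_real abs_exp_cancel norm_one)
    moreover have "exp (- (d k)\<^sup>2 / 2) \<le> exp (- e\<^sup>2 / 2)" for k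
    proof -
      have "e\<^sup>2 \<le> \<bar>d k\<bar>\<^sup>2"
        using mn(3)[of k] e(1) by (intro power_mono) (auto simp: d_def dist_real_def)
      then show ?thesis by simp
    qed
    ultimately have "1 \<le> exp (- e\<^sup>2 / 2)" by (intro LIMSEQ_le_const2) auto
    then show False using e(1) by simp
  qed
  then show ?thesis by (rule Cauchy_convergent)
qed

context prob_space
begin

lemma char_distr: "random_variable borel X \<Longrightarrow> char (distr M borel X) t = (CLINT \<omega>|M. iexp (t * X \<omega>))"
  unfolding char_def by (subst integral_distr) auto

lemma char_affine:
  assumes X: "random_variable borel X"
  shows "char (distr M borel (\<lambda>\<omega>. \<mu> + \<sigma> * X \<omega>)) t = iexp (t * \<mu>) * char (distr M borel X) (\<sigma> * t)"
proof -
  have "char (distr M borel (\<lambda>\<omega>. \<mu> + \<sigma> * X \<omega>)) t = (CLINT \<omega>|M. iexp (t * \<mu>) * iexp ((\<sigma> * t) * X \<omega>))"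
    using X by (subst char_distr) (auto simp: exp_add[symmetric] algebra_simps intro!: Bochner_Integration.integral_cong)
  also have "\<dots> = iexp (t * \<mu>) * (CLINT \<omega>|M. iexp ((\<sigma> * t) * X \<omega>))" by simp
  finally show ?thesis using X by (simp add: char_distr)
qed

lemma distributed_std_normal_iff:
  "distributed M lborel X std_normal_density \<longleftrightarrow>
     random_variable borel X \<and> distr M borel X = std_normal_distribution"
proof -
  have "distr M lborel X = distr M borel X" by (intro distr_cong) auto
  then show ?thesis by (auto simp: distributed_def)
qed

text \<open>Uniqueness of characteristic functions, after standardising \<open>X\<close>. Point
  masses are the case \<open>\<sigma> = 0\<close>, so both alternatives in \<open>normal_rv\<close>
  become one formula that can be followed to a limit.\<close>

lemma normal_rv_iff_char:
  "normal_rv M X \<longleftrightarrow> random_variable borel X \<and>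
    (\<exists>\<mu> \<sigma>. \<sigma> \<ge> 0 \<and> (\<forall>t. char (distr M borel X) t = iexp (t * \<mu>) * complex_of_real (exp (- (\<sigma> * t)\<^sup>2 / 2))))"
  (is "_ \<longleftrightarrow> _ \<and> ?R")
proof (cases "random_variable borel X")
  case X: True
  interpret D: real_distribution "distr M borel X" using X by simp
  have conv: "distributed M lborel X (normal_density \<mu> \<sigma>) \<longleftrightarrow>
      (\<forall>t. char (distr M borel X) t = iexp (t * \<mu>) * complex_of_real (exp (- (\<sigma> * t)\<^sup>2 / 2)))"
    if \<sigma>: "\<sigma> > 0" for \<mu> \<sigma>
  proof -
    define Y where "Y = (\<lambda>\<omega>. (X \<omega> - \<mu>) / \<sigma>)"
    have Y: "random_variable borel Y" using X by (simp add: Y_def)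
    interpret Y: real_distribution "distr M borel Y" using Y by simp
    have XY: "X = (\<lambda>\<omega>. \<mu> + \<sigma> * Y \<omega>)" using \<sigma> by (simp add: Y_def)
    have "distributed M lborel X (normal_density \<mu> \<sigma>) \<longleftrightarrow> distr M borel Y = std_normal_distribution"
      unfolding normal_standard_normal_convert[OF \<sigma>]
      using distributed_std_normal_iff[of Y] Y unfolding Y_def by simp
    also have "\<dots> \<longleftrightarrow> char (distr M borel Y) = char std_normal_distribution"
      using Levy_uniqueness[OF Y.real_distribution_axioms real_dist_normal_dist] by auto
    also have "\<dots> \<longleftrightarrow> (\<forall>t. char (distr M borel Y) (\<sigma> * t) = exp (- (\<sigma> * t)\<^sup>2 / 2))"
    proof
      assume *: "\<forall>t. char (distr M borel Y) (\<sigma> * t) = exp (- (\<sigma> * t)\<^sup>2 / 2)"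
      have "char (distr M borel Y) s = exp (- s\<^sup>2 / 2)" for s
        using *[rule_format, of "s / \<sigma>"] \<sigma> by simp
      then show "char (distr M borel Y) = char std_normal_distribution"
        by (auto simp: char_std_normal_distribution)
    qed (simp add: char_std_normal_distribution)
    also have "\<dots> \<longleftrightarrow> (\<forall>t. char (distr M borel X) t = iexp (t * \<mu>) * complex_of_real (exp (- (\<sigma> * t)\<^sup>2 / 2)))"
      unfolding XY char_affine[OF Y] by simp
    finally show ?thesis .
  qed
  have deg: "distr M borel X = return borel \<mu> \<longleftrightarrow> (\<forall>t. char (distr M borel X) t = iexp (t * \<mu>))" for \<mu>
  proof -
    have ret: "real_distribution (return borel \<mu>)"
      unfolding real_distribution_def real_distribution_axioms_def by (auto intro!: prob_space_return)
    have char_ret: "char (return borel \<mu>) = (\<lambda>t. iexp (t * \<mu>))"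
      unfolding char_def by (rule ext, subst integral_return) auto
    have "distr M borel X = return borel \<mu> \<longleftrightarrow> char (distr M borel X) = char (return borel \<mu>)"
      using Levy_uniqueness[OF D.real_distribution_axioms ret] by metis
    then show ?thesis unfolding char_ret by (simp only: fun_eq_iff)
  qed
  show ?thesis
  proof
    assume "normal_rv M X"
    then consider \<mu> where "distr M borel X = return borel \<mu>"
      | \<mu> \<sigma> where "\<sigma> > 0" "distributed M lborel X (normal_density \<mu> \<sigma>)"
      unfolding normal_rv_def by blast
    then have ?R
    proof cases
      case 1
      then show ?thesis using deg by (intro exI[of _ \<mu>] exI[of _ 0]) simp
    next
      case 2
      then show ?thesis using conv[of \<sigma> \<mu>] by (intro exI[of _ \<mu>] exI[of _ \<sigma>]) simp
    qed
    then show "random_variable borel X \<and> ?R" using X by simp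
  next
    assume "random_variable borel X \<and> ?R"
    then obtain \<mu> \<sigma> where \<sigma>: "\<sigma> \<ge> 0" and
      ch: "\<forall>t. char (distr M borel X) t = iexp (t * \<mu>) * complex_of_real (exp (- (\<sigma> * t)\<^sup>2 / 2))"
      by blast
    show "normal_rv M X"
    proof (cases "\<sigma> = 0")
      case True
      then have "distr M borel X = return borel \<mu>" using deg[of \<mu>] ch by simp
      then show ?thesis unfolding normal_rv_def using X by blast
    next
      case False
      then have s: "\<sigma> > 0" using \<sigma> by simp
      then have "distributed M lborel X (normal_density \<mu> \<sigma>)" using conv[OF s] ch by blast
      then show ?thesis unfolding normal_rv_def using X s by blast
    qed
  qed
qed (auto simp: normal_rv_def)

text \<open>The characteristic functions converge by dominated convergence. This forces first the
  standard deviations and then the means to converge, so the limit has the normal form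
  again.\<close>

lemma normal_rv_LIMSEQ:
  assumes X: "\<And>n. normal_rv M (X n)" and lim: "\<And>\<omega>. \<omega> \<in> space M \<Longrightarrow> (\<lambda>n. X n \<omega>) \<longlonglongrightarrow> Y \<omega>"
  shows "normal_rv M Y"
proof -
  have Xm[measurable]: "random_variable borel (X n)" for n using X by (simp add: normal_rv_def)
  have Ym[measurable]: "random_variable borel Y"
    by (rule borel_measurable_LIMSEQ_real[OF lim]) auto
  interpret D: real_distribution "distr M borel Y" by simp
  define \<phi> where "\<phi> = char (distr M borel Y)"
  have conv: "(\<lambda>n. char (distr M borel (X n)) t) \<longlonglongrightarrow> \<phi> t" for t
    unfolding \<phi>_def char_distr[OF Xm] char_distr[OF Ym]
    by (rule integral_dominated_convergence[where w="\<lambda>_. 1"])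
       (auto intro!: always_eventually tendsto_intros lim AE_I2)
  obtain \<mu> \<sigma> where \<sigma>: "\<And>n. \<sigma> n \<ge> 0" and
    ch: "\<And>n t. char (distr M borel (X n)) t = iexp (t * \<mu> n) * complex_of_real (exp (- (\<sigma> n * t)\<^sup>2 / 2))"
    using X unfolding normal_rv_iff_char by metis
  have "continuous (at 0) \<phi>" unfolding \<phi>_def by (rule D.isCont_char)
  moreover have "\<phi> 0 = 1" unfolding \<phi>_def by (rule D.char_zero)
  ultimately have "\<forall>\<^sub>F t in at 0. \<phi> t \<noteq> 0"
    by (metis continuous_at tendsto_imp_eventually_ne zero_neq_one)
  then obtain r where r: "r > 0" "\<And>t. t \<noteq> 0 \<Longrightarrow> dist t 0 < r \<Longrightarrow> \<phi> t \<noteq> 0"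
    unfolding eventually_at by blast
  \<comment> \<open>A nonzero argument at which \<open>\<phi>\<close> does not vanish, so the
    logarithms of the moduli converge there; the modulus does not see the mean.\<close>
  define u where "u = r / 2"
  have u: "u > 0" "\<phi> u \<noteq> 0" using r(2)[of u] r(1) by (auto simp: u_def)
  have "(\<lambda>n. ln (norm (char (distr M borel (X n)) u))) \<longlonglongrightarrow> ln (norm (\<phi> u))"
    using u(2) by (intro tendsto_ln tendsto_norm conv) auto
  moreover have "ln (norm (char (distr M borel (X n)) u)) = - (\<sigma> n * u)\<^sup>2 / 2" for n
    unfolding ch norm_mult norm_exp_i_times by simp
  ultimately have "(\<lambda>n. - (\<sigma> n * u)\<^sup>2 / 2) \<longlonglongrightarrow> ln (norm (\<phi> u))" by simp
  \<comment> \<open>The square root returns \<open>\<sigma> n\<close> itself because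
    \<open>\<sigma> n \<ge> 0\<close>.\<close>
  then have "(\<lambda>n. sqrt ((- 2 / u\<^sup>2) * (- (\<sigma> n * u)\<^sup>2 / 2))) \<longlonglongrightarrow> sqrt ((- 2 / u\<^sup>2) * ln (norm (\<phi> u)))"
    by (intro tendsto_intros)
  moreover have "sqrt ((- 2 / u\<^sup>2) * (- (\<sigma> n * u)\<^sup>2 / 2)) = \<sigma> n" for n
    using u(1) \<sigma>[of n] by (simp add: power_mult_distrib)
  ultimately obtain s where s: "\<sigma> \<longlonglongrightarrow> s" by auto
  have s0: "s \<ge> 0" using s \<sigma> by (intro LIMSEQ_le_const) auto
  \<comment> \<open>Dividing by the Gaussian factor, whose limit is nonzero, isolates the phase that
    carries the mean.\<close>
  have "(\<lambda>n. iexp (t * \<mu> n)) \<longlonglongrightarrow> \<phi> t / complex_of_real (exp (- (s * t)\<^sup>2 / 2))" for t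
  proof -
    have "(\<lambda>n. char (distr M borel (X n)) t / complex_of_real (exp (- (\<sigma> n * t)\<^sup>2 / 2)))
      \<longlonglongrightarrow> \<phi> t / complex_of_real (exp (- (s * t)\<^sup>2 / 2))"
      by (intro tendsto_intros conv s) auto
    then show ?thesis by (simp add: ch)
  qed
  then have "convergent \<mu>" by (rule convergent_of_convergent_iexp)
  then obtain m where m: "\<mu> \<longlonglongrightarrow> m" by (auto simp: convergent_def)
  have "\<phi> t = iexp (t * m) * complex_of_real (exp (- (s * t)\<^sup>2 / 2))" for t
  proof (rule LIMSEQ_unique[OF conv])
    show "(\<lambda>n. char (distr M borel (X n)) t) \<longlonglongrightarrow> iexp (t * m) * complex_of_real (exp (- (s * t)\<^sup>2 / 2))"
      unfolding ch by (intro tendsto_intros m s) auto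
  qed
  then show ?thesis
    unfolding normal_rv_iff_char \<phi>_def using s0 Ym by blast
qed

end

subsection \<open>Weak convergence of bounded processes\<close>

lemma openin_linf_subset: "openin (mtopology_of (linf S)) U \<Longrightarrow> U \<subseteq> mspace (linf S)"
  by (metis openin_subset topspace_mtopology_of)

lemma space_linf_borel [simp]: "space (linf_borel S) = mspace (linf S)"
  unfolding linf_borel_def by (rule space_measure_of) (auto dest: openin_linf_subset)

lemma sets_linf_borel:
  "sets (linf_borel S) = sigma_sets (mspace (linf S)) {U. openin (mtopology_of (linf S)) U}"
  unfolding linf_borel_def by (rule sets_measure_of) (auto dest: openin_linf_subset)

lemma openin_linf_borel: "openin (mtopology_of (linf S)) U \<Longrightarrow> U \<in> sets (linf_borel S)"
  by (simp add: sets_linf_borel)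

lemma abs_diff_le_mdist_linf:
  assumes f: "f \<in> mspace (linf S)" and g: "g \<in> mspace (linf S)" and s: "s \<in> S"
  shows "\<bar>f s - g s\<bar> \<le> mdist (linf S) f g"
proof -
  obtain a b where ab: "\<And>s. s \<in> S \<Longrightarrow> \<bar>f s\<bar> \<le> a" "\<And>s. s \<in> S \<Longrightarrow> \<bar>g s\<bar> \<le> b"
    using f g unfolding mspace_linf bounded_iff by auto
  have "bdd_above ((\<lambda>s. \<bar>f s - g s\<bar>) ` S)"
  proof (rule bdd_aboveI2)
    show "\<bar>f s - g s\<bar> \<le> a + b" if "s \<in> S" for s using ab[OF that] by linarith
  qed
  then show ?thesis using s f g by (subst mdist_linf) (auto intro: cSUP_upper)
qed

text \<open>The hypothesis \<open>c \<ge> 0\<close> settles \<open>S = {}\<close>, where the space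
  is a single point and \<open>mdist_linf\<close> does not apply.\<close>

lemma mdist_linf_le:
  assumes "f \<in> mspace (linf S)" "g \<in> mspace (linf S)" "\<And>s. s \<in> S \<Longrightarrow> \<bar>f s - g s\<bar> \<le> c" "c \<ge> 0"
  shows "mdist (linf S) f g \<le> c"
proof (cases "S = {}")
  case True
  then have "f = g" using assms(1,2) by (auto simp: mspace_linf extensional_def)
  then have "mdist (linf S) f g = 0" using assms(1,2) by (simp only: mdist_zero)
  then show ?thesis using assms(4) by simp
next
  case False
  then show ?thesis using assms by (subst mdist_linf) (auto intro: cSUP_least)
qed

lemma continuous_map_eval_linf:
  assumes "s \<in> S"
  shows "continuous_map (mtopology_of (linf S)) euclideanreal (\<lambda>f. f s)"
proof -
  have "Lipschitz_continuous_map (linf S) euclidean_metric (\<lambda>f. f s)"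
    unfolding Lipschitz_continuous_map_def
    using abs_diff_le_mdist_linf[OF _ _ assms] by (auto simp: dist_real_def intro!: exI[of _ 1])
  from Lipschitz_continuous_imp_continuous_map[OF this] show ?thesis by simp
qed

lemma borel_measurable_linf_borel:
  assumes "continuous_map (mtopology_of (linf S)) euclideanreal h"
  shows "h \<in> borel_measurable (linf_borel S)"
proof (rule borel_measurableI)
  fix U :: "real set" assume "open U"
  then have "openin (mtopology_of (linf S)) {f \<in> mspace (linf S). h f \<in> U}"
    using assms by (auto dest: openin_continuous_map_preimage)
  then have "{f \<in> mspace (linf S). h f \<in> U} \<in> sets (linf_borel S)" by (rule openin_linf_borel)
  moreover have "h -` U \<inter> space (linf_borel S) = {f \<in> mspace (linf S). h f \<in> U}" by auto
  ultimately show "h -` U \<inter> space (linf_borel S) \<in> sets (linf_borel S)" by simp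
qed

lemma outer_expectation_cong:
  "(\<And>\<omega>. \<omega> \<in> space M \<Longrightarrow> f \<omega> = g \<omega>) \<Longrightarrow> outer_expectation M f = outer_expectation M g"
  unfolding outer_expectation_def by (simp cong: conj_cong ball_cong)

text \<open>The test function is only continuous on \<open>B\<close> after composition with \<open>\<Phi>\<close>; Tietze's theorem
  extends it to all of \<open>\<ell>\<^sup>\<infinity>(S)\<close>, and neither side sees the values of the extension off \<open>B\<close>.\<close>

lemma weakly_converges_continuous_image:
  assumes conv: "weakly_converges S M X N Y"
    and B: "closedin (mtopology_of (linf S)) B"
    and \<Phi>: "continuous_map (subtopology (mtopology_of (linf S)) B) (mtopology_of (linf S')) \<Phi>"
    and XB: "\<And>n \<omega>. \<omega> \<in> space (M n) \<Longrightarrow> X n \<omega> \<in> B"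
    and YB: "\<And>\<omega>. \<omega> \<in> space N \<Longrightarrow> Y \<omega> \<in> B"
  shows "weakly_converges S' M (\<lambda>n \<omega>. \<Phi> (X n \<omega>)) N (\<lambda>\<omega>. \<Phi> (Y \<omega>))"
proof -
  let ?T = "mtopology_of (linf S)"
  have Ym: "Y \<in> measurable N (linf_borel S)" using conv by (simp add: weakly_converges_def)
  have Bsub: "B \<subseteq> mspace (linf S)" using closedin_subset[OF B] by simp
  then have \<Phi>B: "\<Phi> f \<in> mspace (linf S')" if "f \<in> B" for f
    using continuous_map_image_subset_topspace[OF \<Phi>] that by auto
  have "(\<lambda>\<omega>. \<Phi> (Y \<omega>)) \<in> measurable N (linf_borel S')"
  proof (rule measurable_sigma_sets[OF sets_linf_borel])
    show "{U. openin (mtopology_of (linf S')) U} \<subseteq> Pow (mspace (linf S'))"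
      by (auto dest: openin_linf_subset)
    show "(\<lambda>\<omega>. \<Phi> (Y \<omega>)) \<in> space N \<rightarrow> mspace (linf S')" using \<Phi>B YB by auto
    fix U assume "U \<in> {U. openin (mtopology_of (linf S')) U}"
    then have "openin (subtopology ?T B) {f \<in> topspace (subtopology ?T B). \<Phi> f \<in> U}"
      using openin_continuous_map_preimage[OF \<Phi>] by simp
    \<comment> \<open>The preimage of \<open>U\<close> under \<open>\<Phi>\<close> is open only
      relative to \<open>B\<close>; since \<open>Y\<close> stays in \<open>B\<close>, the open set
      \<open>O'\<close> serves in its place.\<close>
    then obtain O' where O': "openin ?T O'" "{f \<in> topspace (subtopology ?T B). \<Phi> f \<in> U} = O' \<inter> B"
      unfolding openin_subtopology by blast
    have "\<Phi> (Y \<omega>) \<in> U \<longleftrightarrow> Y \<omega> \<in> O'" if "\<omega> \<in> space N" for \<omega>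
    proof -
      have "Y \<omega> \<in> topspace (subtopology ?T B)" using YB[OF that] Bsub by auto
      then show ?thesis using O'(2) YB[OF that] by blast
    qed
    then have "(\<lambda>\<omega>. \<Phi> (Y \<omega>)) -` U \<inter> space N = Y -` O' \<inter> space N" by auto
    then show "(\<lambda>\<omega>. \<Phi> (Y \<omega>)) -` U \<inter> space N \<in> sets N"
      using measurable_sets[OF Ym openin_linf_borel[OF O'(1)]] by simp
  qed
  moreover have "(\<lambda>n. outer_expectation (M n) (\<lambda>\<omega>. h (\<Phi> (X n \<omega>)))) \<longlonglongrightarrow> (\<integral>\<omega>. h (\<Phi> (Y \<omega>)) \<partial>N)"
    if h: "continuous_map (mtopology_of (linf S')) euclideanreal h" "bounded (h ` mspace (linf S'))" for h
  proof -
    obtain b where b: "\<And>f. f \<in> mspace (linf S') \<Longrightarrow> \<bar>h f\<bar> \<le> b"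
      using h(2) unfolding bounded_iff by auto
    define c where "c = max b 0"
    have c: "\<bar>h f\<bar> \<le> c" if "f \<in> mspace (linf S')" for f using b[OF that] by (simp add: c_def)
    have "continuous_map (subtopology ?T B) euclideanreal (h \<circ> \<Phi>)"
      using \<Phi> h(1) by (rule continuous_map_compose)
    moreover have "(h \<circ> \<Phi>) ` B \<subseteq> {- c..c}"
      using c \<Phi>B by (fastforce simp: abs_le_iff)
    moreover have "normal_space ?T"
      unfolding mtopology_of_def
      by (intro metrizable_imp_normal_space Metric_space.metrizable_space_mtopology) simp
    ultimately obtain k where k: "continuous_map ?T euclideanreal k"
      "\<And>f. f \<in> B \<Longrightarrow> k f = (h \<circ> \<Phi>) f" "k ` topspace ?T \<subseteq> {- c..c}"
      using Tietze_extension_closed_real_interval[of ?T B "h \<circ> \<Phi>" "- c" c] B by (force simp: c_def)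
    have "bounded (k ` mspace (linf S))"
      using k(3) bounded_subset[OF bounded_closed_interval] by auto
    then have "(\<lambda>n. outer_expectation (M n) (\<lambda>\<omega>. k (X n \<omega>))) \<longlonglongrightarrow> (\<integral>\<omega>. k (Y \<omega>) \<partial>N)"
      using conv k(1) unfolding weakly_converges_def by blast
    moreover have "outer_expectation (M n) (\<lambda>\<omega>. k (X n \<omega>)) = outer_expectation (M n) (\<lambda>\<omega>. h (\<Phi> (X n \<omega>)))" for n
      using k(2) XB by (intro outer_expectation_cong) simp
    moreover have "(\<integral>\<omega>. k (Y \<omega>) \<partial>N) = (\<integral>\<omega>. h (\<Phi> (Y \<omega>)) \<partial>N)"
      using k(2) YB by (intro Bochner_Integration.integral_cong) auto
    ultimately show ?thesis by simp
  qed
  ultimately show ?thesis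
    unfolding weakly_converges_def using \<Phi>B XB by auto
qed

lemma weakly_converges_cong:
  assumes "\<And>n \<omega>. \<omega> \<in> space (M n) \<Longrightarrow> X n \<omega> = X' n \<omega>" "weakly_converges S M X N Y"
  shows "weakly_converges S M X' N Y"
proof -
  have "outer_expectation (M n) (\<lambda>\<omega>. h (X n \<omega>)) = outer_expectation (M n) (\<lambda>\<omega>. h (X' n \<omega>))"
    for h :: "_ \<Rightarrow> real" and n
    using assms(1) by (intro outer_expectation_cong) simp
  moreover have "X' n \<in> space (M n) \<rightarrow> mspace (linf S)" for n
    using assms unfolding weakly_converges_def by (fastforce simp: Pi_iff)
  ultimately show ?thesis using assms(2) unfolding weakly_converges_def by simp
qed

section \<open>Transfer of a process to the law of its sample paths\<close>

lemma gaussian_process_imp_normal_rv: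
  "gaussian_process N S X \<Longrightarrow> finite I \<Longrightarrow> I \<subseteq> S \<Longrightarrow> normal_rv N (\<lambda>\<omega>. \<Sum>s\<in>I. a s * X \<omega> s)"
  by (simp add: gaussian_process_def)

text \<open>The range of \<open>Y\<close> need not be measurable; restricting to it makes every outcome a sample path
  of \<open>Y\<close>, so that pathwise properties pass to the law.\<close>

definition path_law :: "'s set \<Rightarrow> 'b measure \<Rightarrow> ('b \<Rightarrow> 's \<Rightarrow> real) \<Rightarrow> ('s \<Rightarrow> real) measure" where
  "path_law S N Y = distr N (restrict_space (linf_borel S) (Y ` space N)) Y"

context
  fixes S :: "'s set" and N :: "'b measure" and Y :: "'b \<Rightarrow> 's \<Rightarrow> real"
  assumes Y: "Y \<in> measurable N (linf_borel S)"
begin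

lemma measurable_path_restrict: "Y \<in> measurable N (restrict_space (linf_borel S) (Y ` space N))"
  using Y by (rule measurable_restrict_space2[rotated]) auto

lemma space_path_law: "space (path_law S N Y) = Y ` space N"
  using measurable_space[OF Y] by (auto simp: path_law_def space_restrict_space)

lemma prob_space_path_law: "prob_space N \<Longrightarrow> prob_space (path_law S N Y)"
  unfolding path_law_def by (rule prob_space.prob_space_distr[OF _ measurable_path_restrict])

lemma measurable_path_law: "f \<in> measurable (linf_borel S) L \<Longrightarrow> f \<in> measurable (path_law S N Y) L"
  unfolding path_law_def by (simp add: measurable_restrict_space1)

lemma normal_rv_path_law:
  assumes f: "f \<in> borel_measurable (linf_borel S)" and n: "normal_rv N (\<lambda>\<omega>. f (Y \<omega>))"
  shows "normal_rv (path_law S N Y) f"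
proof -
  \<comment> \<open>The target \<open>L\<close> is kept general because \<open>normal_rv\<close>
    refers to \<open>borel\<close> for point masses and to \<open>lborel\<close> for
    densities.\<close>
  have "distr (path_law S N Y) L f = distr N L (\<lambda>\<omega>. f (Y \<omega>))" if "sets L = sets borel" for L :: "real measure"
    unfolding path_law_def using f that
    by (subst distr_distr)
       (auto simp: comp_def measurable_path_restrict measurable_restrict_space1 cong: measurable_cong_sets)
  then show ?thesis
    using n measurable_path_law[OF f] unfolding normal_rv_def distributed_def by simp blast
qed

lemma gaussian_process_path_law:
  assumes "gaussian_process N S Y"
  shows "gaussian_process (path_law S N Y) S (\<lambda>y. y)"
proof -
  have eval: "(\<lambda>y. y s) \<in> borel_measurable (linf_borel S)" if "s \<in> S" for s
    by (rule borel_measurable_linf_borel[OF continuous_map_eval_linf[OF that]])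
  show ?thesis
    unfolding gaussian_process_def stochastic_process_def
  proof (intro conjI ballI allI impI)
    show "(\<lambda>y. y s) \<in> borel_measurable (path_law S N Y)" if "s \<in> S" for s
      by (rule measurable_path_law[OF eval[OF that]])
    fix I a assume I: "finite I \<and> I \<subseteq> S"
    then have "normal_rv N (\<lambda>\<omega>. \<Sum>s\<in>I. a s * Y \<omega> s)"
      by (intro gaussian_process_imp_normal_rv[OF assms]) auto
    moreover have "(\<lambda>y. \<Sum>s\<in>I. a s * y s) \<in> borel_measurable (linf_borel S)"
      using eval I by (intro borel_measurable_sum borel_measurable_times borel_measurable_const) auto
    ultimately show "normal_rv (path_law S N Y) (\<lambda>y. \<Sum>s\<in>I. a s * y s)"
      by (rule normal_rv_path_law[rotated])
  qed
qed

lemma weakly_converges_path_law: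
  assumes conv: "weakly_converges S M X N Y"
  shows "weakly_converges S M X (path_law S N Y) (\<lambda>y. y)"
proof -
  have "(\<integral>y. h y \<partial>path_law S N Y) = (\<integral>\<omega>. h (Y \<omega>) \<partial>N)"
    if "continuous_map (mtopology_of (linf S)) euclideanreal h" for h
    unfolding path_law_def
    using borel_measurable_linf_borel[OF that] measurable_path_restrict
    by (subst integral_distr) (auto simp: measurable_restrict_space1)
  moreover have "(\<lambda>y. y) \<in> measurable (path_law S N Y) (linf_borel S)"
    by (rule measurable_path_law) simp
  ultimately show ?thesis using conv unfolding weakly_converges_def by simp
qed

end

text \<open>The points \<open>p j\<close> may coincide, as endpoints shared by neighbouring cells
  do. Coefficients at a common point are collected to obtain a sum over a set of indices.\<close>

lemma gaussian_process_sum: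
  assumes gp: "gaussian_process N S X" and "finite J" "p ` J \<subseteq> S"
  shows "normal_rv N (\<lambda>\<omega>. \<Sum>j\<in>J. b j * X \<omega> (p j))"
proof -
  have "(\<Sum>j\<in>J. b j * X \<omega> (p j)) = (\<Sum>s\<in>p ` J. (\<Sum>j\<in>{j \<in> J. p j = s}. b j) * X \<omega> s)" for \<omega>
    by (subst sum.image_gen[OF \<open>finite J\<close>, of _ p]) (auto simp: sum_distrib_right intro!: sum.cong)
  moreover have "normal_rv N (\<lambda>\<omega>. \<Sum>s\<in>p ` J. (\<Sum>j\<in>{j \<in> J. p j = s}. b j) * X \<omega> s)"
    using assms(2,3) by (intro gaussian_process_imp_normal_rv[OF gp]) auto
  ultimately show ?thesis by (simp only:)
qed

text \<open>A linear combination of the limits is a pointwise limit of linear combinations of values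
  of \<open>X\<close> on the grid, which are normal.\<close>

lemma gaussian_process_rs_lim:
  assumes N: "prob_space N" and gp: "gaussian_process N UNIV X"
    and conv: "\<And>\<omega> g. \<omega> \<in> space N \<Longrightarrow> g \<in> G \<Longrightarrow> convergent (\<lambda>k. rs_sum k g (X \<omega>))"
  shows "gaussian_process N G (\<lambda>\<omega>. \<lambda>g\<in>G. rs_lim g (X \<omega>))"
proof -
  have normal: "normal_rv N (\<lambda>\<omega>. \<Sum>g\<in>I. a g * (\<lambda>g\<in>G. rs_lim g (X \<omega>)) g)"
    if I: "finite I" "I \<subseteq> G" for I a
  proof (rule prob_space.normal_rv_LIMSEQ[OF N])
    show "(\<lambda>k. \<Sum>g\<in>I. a g * rs_sum k g (X \<omega>)) \<longlonglongrightarrow> (\<Sum>g\<in>I. a g * (\<lambda>g\<in>G. rs_lim g (X \<omega>)) g)"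
      if "\<omega> \<in> space N" for \<omega>
      using I conv[OF that] by (intro tendsto_intros) (auto intro: rs_lim_LIMSEQ)
    fix k
    \<comment> \<open>The triple \<open>(g, i, e)\<close> picks cell \<open>i\<close> in the sum for
      \<open>g\<close>; \<open>e\<close> is true for the right endpoint, with sign plus, and false
      for the left one, with sign minus.\<close>
    define b where "b = (\<lambda>(g, i, e). a g * (g (grid k (Suc i)) * (if e then 1 else -1)))"
    define p where "p = (\<lambda>(g :: real \<Rightarrow> real, i, e). grid k (if e then Suc i else i))"
    have "(\<Sum>j\<in>I \<times> {..<2 * k * 2 ^ k} \<times> UNIV. b j * z (p j)) = (\<Sum>g\<in>I. a g * rs_sum k g z)" for z
    proof -
      have "(\<Sum>j\<in>I \<times> {..<2 * k * 2 ^ k} \<times> UNIV. b j * z (p j)) =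
          (\<Sum>g\<in>I. \<Sum>i<2 * k * 2 ^ k. \<Sum>e\<in>UNIV. b (g, i, e) * z (p (g, i, e)))"
        by (simp add: sum.cartesian_product case_prod_unfold)
      also have "\<dots> = (\<Sum>g\<in>I. a g * rs_sum k g z)"
        by (simp add: b_def p_def rs_sum_def UNIV_bool sum_distrib_left algebra_simps)
      finally show ?thesis .
    qed
    then show "normal_rv N (\<lambda>\<omega>. \<Sum>g\<in>I. a g * rs_sum k g (X \<omega>))"
      using gaussian_process_sum[OF gp, of "I \<times> {..<2 * k * 2 ^ k} \<times> UNIV" p b] I by simp
  qed
  have "(\<lambda>\<omega>. (\<lambda>g\<in>G. rs_lim g (X \<omega>)) g) \<in> borel_measurable N" if "g \<in> G" for g
    using normal[of "{g}" "\<lambda>_. 1"] that by (simp add: normal_rv_def)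
  then show ?thesis
    unfolding gaussian_process_def stochastic_process_def by (intro conjI ballI allI impI normal) auto
qed

section \<open>The limit functional on a closed set of integrators\<close>

definition rs_domain :: "(real \<Rightarrow> real) set \<Rightarrow> (real \<Rightarrow> real) set" where
  "rs_domain G = {z \<in> mspace (linf UNIV). \<forall>g\<in>G. convergent (\<lambda>k. rs_sum k g z)}"

context
  fixes G :: "(real \<Rightarrow> real) set" and T :: real
  assumes G: "G \<subseteq> BV T" and T: "T > 0"
begin

lemma closedin_rs_domain: "closedin (mtopology_of (linf UNIV)) (rs_domain G)"
proof -
  interpret L: Metric_space "mspace (linf UNIV)" "mdist (linf (UNIV :: real set))" by simp
  have "z \<in> rs_domain G" if z: "z \<in> mspace (linf UNIV)"
    and near: "\<And>r. r > 0 \<Longrightarrow> \<exists>w\<in>rs_domain G. mdist (linf UNIV) z w < r" for z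
    unfolding rs_domain_def
  proof (intro CollectI conjI ballI z)
    fix g assume g: "g \<in> G"
    show "convergent (\<lambda>k. rs_sum k g z)"
    proof (rule rs_sum_convergent_uniform_limit[OF _ T])
      show "g \<in> BV T" using g G by blast
      fix e :: real assume "e > 0"
      then obtain w where w: "w \<in> rs_domain G" "mdist (linf UNIV) z w < e" using near by blast
      then have "\<bar>z x - w x\<bar> \<le> e" for x
        using abs_diff_le_mdist_linf[OF z, of w x] by (auto simp: rs_domain_def)
      then show "\<exists>w. (\<forall>x. \<bar>z x - w x\<bar> \<le> e) \<and> convergent (\<lambda>k. rs_sum k g w)"
        using w(1) g by (auto simp: rs_domain_def)
    qed
  qed
  then have "\<exists>r>0. disjnt (rs_domain G) (L.mball z r)" if "z \<in> mspace (linf UNIV) - rs_domain G" for z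
    using that unfolding disjnt_iff L.in_mball by (meson DiffE)
  then show ?thesis
    unfolding mtopology_of_def L.closedin_metric by (auto simp: rs_domain_def)
qed

text \<open>The estimate with constant \<open>3 * T\<close> holds for all \<open>g \<in> G\<close>
  at once, so the map is Lipschitz for the supremum metrics. Comparison with the zero integrator
  shows that its values are bounded.\<close>

lemma continuous_map_rs_lim:
  "continuous_map (subtopology (mtopology_of (linf UNIV)) (rs_domain G)) (mtopology_of (linf G))
     (\<lambda>z. \<lambda>g\<in>G. rs_lim g z)"
proof -
  have maps: "(\<lambda>g\<in>G. rs_lim g z) \<in> mspace (linf G)" if z: "z \<in> rs_domain G" for z
  proof -
    obtain c where c: "\<And>x. \<bar>z x\<bar> \<le> c"
      using z unfolding rs_domain_def mspace_linf bounded_iff by auto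
    have zero: "rs_sum k g (\<lambda>_. 0) = 0" for k g by (simp add: rs_sum_def)
    have "\<bar>rs_lim g z\<bar> \<le> 3 * T * c" if "g \<in> G" for g
      using abs_rs_lim_diff_le[of g T z "\<lambda>_. 0" c] that z c G T
      by (auto simp: rs_domain_def zero rs_lim_def convergent_const)
    then show ?thesis by (auto simp: mspace_linf bounded_iff)
  qed
  have "Lipschitz_continuous_map (submetric (linf UNIV) (rs_domain G)) (linf G) (\<lambda>z. \<lambda>g\<in>G. rs_lim g z)"
    unfolding Lipschitz_continuous_map_def
  proof (intro conjI exI[of _ "3 * T"] ballI)
    show "(\<lambda>z. \<lambda>g\<in>G. rs_lim g z) \<in> mspace (submetric (linf UNIV) (rs_domain G)) \<rightarrow> mspace (linf G)"
      using maps by auto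
    fix z w assume "z \<in> mspace (submetric (linf UNIV) (rs_domain G))" "w \<in> mspace (submetric (linf UNIV) (rs_domain G))"
    then have zw: "z \<in> rs_domain G" "w \<in> rs_domain G" by auto
    then have zw': "z \<in> mspace (linf UNIV)" "w \<in> mspace (linf UNIV)" by (auto simp: rs_domain_def)
    have "mdist (linf G) (\<lambda>g\<in>G. rs_lim g z) (\<lambda>g\<in>G. rs_lim g w) \<le> 3 * T * mdist (linf UNIV) z w"
    proof (rule mdist_linf_le[OF maps[OF zw(1)] maps[OF zw(2)]])
      fix g assume g: "g \<in> G"
      have "\<bar>rs_lim g z - rs_lim g w\<bar> \<le> 3 * T * mdist (linf UNIV) z w"
        using g G T zw
        by (intro abs_rs_lim_diff_le abs_diff_le_mdist_linf zw') (auto simp: rs_domain_def)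
      then show "\<bar>(\<lambda>g\<in>G. rs_lim g z) g - (\<lambda>g\<in>G. rs_lim g w) g\<bar> \<le> 3 * T * mdist (linf UNIV) z w"
        using g by simp
    qed (use T in simp)
    then show "mdist (linf G) (\<lambda>g\<in>G. rs_lim g z) (\<lambda>g\<in>G. rs_lim g w)
        \<le> 3 * T * mdist (submetric (linf UNIV) (rs_domain G)) z w" by simp
  qed
  from Lipschitz_continuous_imp_continuous_map[OF this] show ?thesis
    by (simp add: mtopology_of_submetric)
qed

end

theorem theorem1:
  fixes M :: "nat \<Rightarrow> 'a measure" and Z\<^sub>n :: "nat \<Rightarrow> 'a \<Rightarrow> real \<Rightarrow> real"
    and N :: "'b measure" and Z :: "'b \<Rightarrow> real \<Rightarrow> real"
    and F\<^sub>0 :: "real \<Rightarrow> real" and T :: real and G :: "(real \<Rightarrow> real) set"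
  assumes "\<And>n. prob_space (M n)"
    and "\<And>n. stochastic_process (M n) UNIV (Z\<^sub>n n)"
    and "\<And>n \<omega>. \<omega> \<in> space (M n) \<Longrightarrow> (Z\<^sub>n n \<omega> \<longlongrightarrow> 0) at_infinity"
    and "\<And>n \<omega>. \<omega> \<in> space (M n) \<Longrightarrow> right_continuous (Z\<^sub>n n \<omega>)"
    and "\<And>n \<omega>. \<omega> \<in> space (M n) \<Longrightarrow> tv_norm (Z\<^sub>n n \<omega>) < \<infinity>"
    and "prob_space N"
    and "gaussian_process N UNIV Z"
    and "distribution_function F\<^sub>0"
    and "\<And>\<omega>. \<omega> \<in> space N \<Longrightarrow> unif_cont_wrt UNIV (\<lambda>s t. \<bar>F\<^sub>0 s - F\<^sub>0 t\<bar>) (Z \<omega>)"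
    and "weakly_converges UNIV M Z\<^sub>n N Z"
    and "T > 0"
    and "G \<subseteq> BV_rc T"
  shows "\<exists>(N' :: ((real \<Rightarrow> real) \<Rightarrow> real) measure) Zbar.
           prob_space N' \<and> gaussian_process N' G Zbar \<and>
           (\<forall>\<omega>\<in>space N'. unif_cont_wrt G (L1_dist F\<^sub>0) (Zbar \<omega>)) \<and>
           weakly_converges G M (\<lambda>n \<omega>. \<lambda>g\<in>G. ls_integral g (Z\<^sub>n n \<omega>)) N' Zbar"
proof -
  define \<Phi> where "\<Phi> = (\<lambda>z. \<lambda>g\<in>G. rs_lim g z)"
  have GBV: "G \<subseteq> BV T" using assms(12) by (auto simp: BV_rc_def)
  have Zm: "Z \<in> measurable N (linf_borel UNIV)"
    and Zn: "\<And>n \<omega>. \<omega> \<in> space (M n) \<Longrightarrow> Z\<^sub>n n \<omega> \<in> mspace (linf UNIV)"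
    using assms(10) unfolding weakly_converges_def by auto
  have ls: "(\<lambda>k. rs_sum k g (Z\<^sub>n n \<omega>)) \<longlonglongrightarrow> ls_integral g (Z\<^sub>n n \<omega>)"
    if "\<omega> \<in> space (M n)" "g \<in> G" for n \<omega> g
    by (rule rs_sum_LIMSEQ_ls_integral[OF assms(5,4)[OF that(1)], where b = T])
       (use that(2) assms(12) in \<open>auto simp: BV_rc_def BV_def\<close>)
  then have ZnB: "Z\<^sub>n n \<omega> \<in> rs_domain G" if "\<omega> \<in> space (M n)" for n \<omega>
    unfolding rs_domain_def using Zn that by (auto simp: convergent_def)
  have bound: "\<exists>c. \<forall>x. \<bar>Z \<omega> x\<bar> \<le> c" if "\<omega> \<in> space N" for \<omega>
    using measurable_space[OF Zm that] by (auto simp: mspace_linf bounded_iff)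
  \<comment> \<open>Paths of \<open>Z\<close> are not assumed to have bounded variation; here
    convergence rests on their uniform continuity with respect to \<open>F\<^sub>0\<close>.\<close>
  have conv: "convergent (\<lambda>k. rs_sum k g (Z \<omega>))" if "\<omega> \<in> space N" "g \<in> G" for \<omega> g
    using bound[OF that(1)] that(2) assms(12)
      rs_sum_convergent_unif_cont[OF assms(8) assms(11) assms(9)[OF that(1)]] by blast
  have ZB: "Z \<omega> \<in> rs_domain G" if "\<omega> \<in> space N" for \<omega>
    using measurable_space[OF Zm that] conv[OF that] by (simp add: rs_domain_def)
  have "weakly_converges G M (\<lambda>n \<omega>. \<Phi> (Z\<^sub>n n \<omega>)) N (\<lambda>\<omega>. \<Phi> (Z \<omega>))"
    unfolding \<Phi>_def
    by (rule weakly_converges_continuous_image[OF assms(10) closedin_rs_domain[OF GBV assms(11)]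
          continuous_map_rs_lim[OF GBV assms(11)] ZnB ZB])
  \<comment> \<open>On the paths of \<open>Z\<^sub>n\<close> the limit of the sums is the
    Lebesgue-Stieltjes integral.\<close>
  moreover have "\<Phi> (Z\<^sub>n n \<omega>) = (\<lambda>g\<in>G. ls_integral g (Z\<^sub>n n \<omega>))" if "\<omega> \<in> space (M n)" for n \<omega>
    unfolding \<Phi>_def rs_lim_def using ls[OF that] by (intro restrict_ext limI)
  ultimately have W: "weakly_converges G M (\<lambda>n \<omega>. \<lambda>g\<in>G. ls_integral g (Z\<^sub>n n \<omega>)) N (\<lambda>\<omega>. \<Phi> (Z \<omega>))"
    by (rule weakly_converges_cong[rotated])
  then have m: "(\<lambda>\<omega>. \<Phi> (Z \<omega>)) \<in> measurable N (linf_borel G)"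
    by (simp add: weakly_converges_def)
  have gp: "gaussian_process N G (\<lambda>\<omega>. \<Phi> (Z \<omega>))"
    unfolding \<Phi>_def by (rule gaussian_process_rs_lim[OF assms(6,7) conv])
  have uc: "unif_cont_wrt G (L1_dist F\<^sub>0) (\<Phi> (Z \<omega>))" if \<omega>: "\<omega> \<in> space N" for \<omega>
  proof -
    obtain c where "\<And>x. \<bar>Z \<omega> x\<bar> \<le> c" using bound[OF \<omega>] by blast
    then have "unif_cont_wrt (BV_rc T) (L1_dist F\<^sub>0) (\<lambda>g. rs_lim g (Z \<omega>))"
      by (rule unif_cont_rs_lim[OF assms(8) assms(11) assms(9)[OF \<omega>]])
    then show ?thesis
      unfolding unif_cont_wrt_def \<Phi>_def using assms(12)
      by (simp add: subset_iff) meson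
  qed
  show ?thesis
    \<comment> \<open>\<open>N'\<close> must live on functions of \<open>g\<close>, while
      \<open>N\<close> has an arbitrary outcome type. The path law with the identity as process
      moves the limit there, and each of its outcomes is some
      \<open>\<Phi> (Z \<omega>)\<close>.\<close>
    by (intro exI[of _ "path_law G N (\<lambda>\<omega>. \<Phi> (Z \<omega>))"] exI[of _ "\<lambda>y. y"] conjI ballI
        prob_space_path_law[OF m assms(6)] gaussian_process_path_law[OF m gp]
        weakly_converges_path_law[OF m W])
       (auto simp: space_path_law[OF m] uc)
qed

end
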